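(* For $n$ odd, there are at least $2^{(n-5)/2}$ pairwise non-homeomorphic 2-page book drawings of $K_n$ with exactly $Z(n)=\frac14\lfloor\frac n2\rfloor\lfloor\frac{n-1}2\rfloor\lfloor\frac{n-2}2\rfloor\lfloor\frac{n-3}2\rfloor$ crossings (crossing optimal drawings).
   Context: A 2-page book drawing of $K_n$ has all vertices on a line (spine) and each edge a simple arc in one of the two closed half-planes bounded by the spine. Two drawings are homeomorphic if there is a homeomorphism of the plane carrying the vertices and edges of one onto the vertices and edges of the other. *)

theory Defs
  imports "HOL-Analysis.Analysis"
begin

text \<open>The plane is the complex plane; the spine is the real axis. A drawing of K_n
is a pair (vx, ed): vertex k (k < n) sits at the point vx k on the real axis and,
for i < j < n, the edge {i,j} is drawn as the path ed i j.\<close>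

type_synonym drawing = "(nat \<Rightarrow> real) \<times> (nat \<Rightarrow> nat \<Rightarrow> real \<Rightarrow> complex)"

definition kn_edges :: "nat \<Rightarrow> (nat \<times> nat) set" where
  "kn_edges n = {(i, j). i < j \<and> j < n}"

definition vertex_points :: "nat \<Rightarrow> drawing \<Rightarrow> complex set" where
  "vertex_points n D = (\<lambda>k. complex_of_real (fst D k)) ` {..<n}"

definition edge_image :: "drawing \<Rightarrow> nat \<times> nat \<Rightarrow> complex set" where
  "edge_image D e = path_image (snd D (fst e) (snd e))"

definition edge_images :: "nat \<Rightarrow> drawing \<Rightarrow> complex set set" where
  "edge_images n D = edge_image D ` kn_edges n"

definition two_page_drawing :: "nat \<Rightarrow> drawing \<Rightarrow> bool" where
  "two_page_drawing n D \<longleftrightarrow>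
     inj_on (fst D) {..<n} \<and>
     (\<forall>(i, j) \<in> kn_edges n.
        arc (snd D i j) \<and>
        pathstart (snd D i j) = complex_of_real (fst D i) \<and>
        pathfinish (snd D i j) = complex_of_real (fst D j) \<and>
        (path_image (snd D i j) \<subseteq> {z. 0 \<le> Im z} \<or>
         path_image (snd D i j) \<subseteq> {z. Im z \<le> 0}) \<and>
        path_image (snd D i j) \<inter> vertex_points n D
          \<subseteq> {complex_of_real (fst D i), complex_of_real (fst D j)}) \<and>
     (\<forall>e \<in> kn_edges n. \<forall>f \<in> kn_edges n. e \<noteq> f \<longrightarrow>
        finite (edge_image D e \<inter> edge_image D f))"

definition crossings :: "nat \<Rightarrow> drawing \<Rightarrow> nat" where
  "crossings n D = (\<Sum>P \<in> {P. P \<subseteq> kn_edges n \<and> card P = 2}.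
      card ((\<Inter>e \<in> P. edge_image D e) - vertex_points n D))"

definition homeomorphic_drawings :: "nat \<Rightarrow> drawing \<Rightarrow> drawing \<Rightarrow> bool" where
  "homeomorphic_drawings n D1 D2 \<longleftrightarrow>
     (\<exists>h g. homeomorphism UNIV UNIV h g \<and>
        h ` vertex_points n D1 = vertex_points n D2 \<and>
        (\<lambda>A. h ` A) ` edge_images n D1 = edge_images n D2)"

definition Z :: "nat \<Rightarrow> real" where
  "Z n = of_int ((int n div 2) * ((int n - 1) div 2) * ((int n - 2) div 2) * ((int n - 3) div 2)) / 4"

end

theory Submission
  imports Defs
begin

text \<open>
  Put \<open>n = 2m + 1\<close>, draw the edges as parabolic arcs over the integer points \<open>0, \<dots>, n - 1\<close>, and
  let the page of an edge be a function of the sum of its ends modulo \<open>n\<close>: sums \<open>1, \<dots>, m\<close> go above,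
  sums \<open>m + 1, \<dots>, 2m\<close> below, while the pairwise non-crossing edges \<open>{k, n - k}\<close> of sum \<open>0\<close> may be
  placed freely. The reflection \<open>i \<mapsto> -i\<close> exchanges the two pages and fixes every free edge, so a
  free edge meets equally many edges of either page and the number of crossings does not depend on
  the choice. For the rotationally symmetric family it is found by averaging over all rotations.

  A homeomorphism permutes the vertices and preserves which pairs of edges cross. For \<open>m \<ge> 4\<close> the
  uncrossed edges are exactly those of the \<open>n\<close>-cycle, so the permutation is dihedral; comparing the
  pages of each edge and of its rotation by one step then shows that, if both pages contain free edges,
  only the identity and \<open>i \<mapsto> -i\<close> are possible. The latter flips all free edges, hence is excluded by
  fixing the page of \<open>{1, n - 1}\<close>. For \<open>m = 3\<close> the two drawings differ in the number of edges with
  three crossings.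
\<close>

section \<open>Drawings by parabolic arcs\<close>

text \<open>Up to the sign of the page all arcs have the same leading coefficient, so two distinct
  arcs on one page differ by an affine function of \<open>x\<close> and meet at most once.\<close>

definition parabola :: "bool \<Rightarrow> nat \<Rightarrow> nat \<Rightarrow> real \<Rightarrow> complex" where
  "parabola up i j x = Complex x ((if up then 1 else -1) * ((x - real i) * (real j - x)))"

definition book :: "(nat \<Rightarrow> nat \<Rightarrow> bool) \<Rightarrow> drawing" where
  "book c = (real, \<lambda>i j t. parabola (c i j) i j (real i + (real j - real i) * t))"

text \<open>Minima and maxima are taken because the permutations considered later need not be
  monotone. A degenerate edge with equal ends is linked with nothing.\<close>

definition linked :: "nat \<Rightarrow> nat \<Rightarrow> nat \<Rightarrow> nat \<Rightarrow> bool" where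
  "linked i j k l \<longleftrightarrow>
     min i j < min k l \<and> min k l < max i j \<and> max i j < max k l \<or>
     min k l < min i j \<and> min i j < max k l \<and> max k l < max i j"

definition crossing :: "(nat \<Rightarrow> nat \<Rightarrow> bool) \<Rightarrow> nat \<Rightarrow> nat \<Rightarrow> nat \<Rightarrow> nat \<Rightarrow> bool" where
  "crossing c i j k l \<longleftrightarrow> linked i j k l \<and> c i j = c k l"

lemma vertex_points_book: "vertex_points n (book c) = (\<lambda>k. complex_of_real (real k)) ` {..<n}"
  by (simp add: vertex_points_def book_def)

lemma edge_image_book:
  assumes "i < j"
  shows "edge_image (book c) (i, j) = parabola (c i j) i j ` {real i..real j}"
proof -
  have "(\<lambda>t. real i + (real j - real i) * t) ` {0..1} = {real i..real j}"
    using image_affinity_atLeastAtMost[of "real j - real i" "real i" 0 1] assms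
    by (simp add: add.commute)
  then have "parabola (c i j) i j ` {real i..real j} =
      (\<lambda>t. parabola (c i j) i j (real i + (real j - real i) * t)) ` {0..1}"
    by (metis image_image)
  then show ?thesis
    by (simp add: edge_image_def book_def path_image_def)
qed

lemma parabola_ends:
  "parabola u i j (real i) = complex_of_real (real i)"
  "parabola u i j (real j) = complex_of_real (real j)"
  by (simp_all add: parabola_def complex_eq_iff)

lemma edge_image_book_vertices:
  assumes "i < j" "j < n"
  shows "edge_image (book c) (i, j) \<inter> vertex_points n (book c) =
    {complex_of_real (real i), complex_of_real (real j)}"
proof -
  have "real i \<in> {real i..real j}" "real j \<in> {real i..real j}"
    using assms by auto
  then have "complex_of_real (real i) \<in> edge_image (book c) (i, j)"
    "complex_of_real (real j) \<in> edge_image (book c) (i, j)"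
    unfolding edge_image_book[OF assms(1)] by (metis image_eqI parabola_ends)+
  moreover have "k = i \<or> k = j"
    if "complex_of_real (real k) \<in> edge_image (book c) (i, j)" for k
    using that unfolding edge_image_book[OF assms(1)]
    by (auto simp: parabola_def complex_eq_iff split: if_splits)
  ultimately show ?thesis
    using assms by (auto simp: vertex_points_book)
qed

lemma edge_image_book_iff:
  assumes "i < j"
  shows "z \<in> edge_image (book c) (i, j) \<longleftrightarrow> real i \<le> Re z \<and> Re z \<le> real j \<and>
    Im z = (if c i j then 1 else -1) * ((Re z - real i) * (real j - Re z))"
  unfolding edge_image_book[OF assms] by (auto simp: parabola_def image_iff complex_eq_iff)

text \<open>Widening the interval raises each factor, so the arc over the wider interval lies weakly
  above the other. Agreement at \<open>x\<close> turns both estimates into equalities, and as the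
  intervals differ this can happen only at an end of the wider one.\<close>

lemma parabolas_meet_aux:
  fixes x a b c d :: real
  assumes "(x - a) * (b - x) = (x - c) * (d - x)"
    and "a \<le> c" "d \<le> b" "c \<le> x" "x \<le> d" "a < c \<or> d < b"
  shows "x = a \<or> x = b"
proof -
  have "(x - c) * (d - x) \<le> (x - a) * (d - x)"
    using assms by (intro mult_right_mono) auto
  moreover have "(x - a) * (d - x) \<le> (x - a) * (b - x)"
    using assms by (intro mult_left_mono) auto
  ultimately have "(x - c) * (d - x) = (x - a) * (d - x)" "(x - a) * (d - x) = (x - a) * (b - x)"
    using assms by linarith+
  then show ?thesis
    using assms by auto
qed

text \<open>Edges on different pages meet only on the spine. On one page, intervals that are not
  linked are disjoint, touch at an end or are nested, and \<open>parabolas_meet_aux\<close> settles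
  the nested case.\<close>

lemma parabolas_not_crossing:
  assumes "i < j" "k < l" "j < n" "l < n" "(i, j) \<noteq> (k, l)" "\<not> crossing c i j k l"
  shows "edge_image (book c) (i, j) \<inter> edge_image (book c) (k, l) \<subseteq> vertex_points n (book c)"
proof
  fix z
  assume "z \<in> edge_image (book c) (i, j) \<inter> edge_image (book c) (k, l)"
  then have z: "real i \<le> Re z" "Re z \<le> real j" "real k \<le> Re z" "Re z \<le> real l"
    and im1: "Im z = (if c i j then 1 else -1) * ((Re z - real i) * (real j - Re z))"
    and im2: "Im z = (if c k l then 1 else -1) * ((Re z - real k) * (real l - Re z))"
    using assms by (auto simp: edge_image_book_iff)
  have nn: "(Re z - real i) * (real j - Re z) \<ge> 0" "(Re z - real k) * (real l - Re z) \<ge> 0"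
    using z by auto
  have "Re z \<in> real ` {i, j, k, l}"
  proof (cases "c i j = c k l")
    case False
    then have "(Re z - real i) * (real j - Re z) = 0"
      using im1 im2 nn by (cases "c i j"; cases "c k l"; simp only: if_True if_False; linarith)
    then show ?thesis
      by auto
  next
    case True
    then have eq: "(Re z - real i) * (real j - Re z) = (Re z - real k) * (real l - Re z)"
      using im1 im2 by (auto split: if_splits)
    have "\<not> linked i j k l"
      using assms True by (auto simp: crossing_def)
    then consider "j \<le> k" | "l \<le> i" | "i \<le> k" "l \<le> j" | "k \<le> i" "j \<le> l"
      using assms by (auto simp: linked_def min_def max_def split: if_splits; linarith)
    then show ?thesis
    proof cases
      case 1
      then have "Re z = real j" using z by linarith
      then show ?thesis by simp
    next
      case 2
      then have "Re z = real i" using z by linarith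
      then show ?thesis by simp
    next
      case 3
      then have "Re z = real i \<or> Re z = real j"
        using parabolas_meet_aux[OF eq] z assms by auto
      then show ?thesis by auto
    next
      case 4
      then have "Re z = real k \<or> Re z = real l"
        using parabolas_meet_aux[OF eq[symmetric]] z assms by auto
      then show ?thesis by auto
    qed
  qed
  then obtain v where v: "v \<in> {i, j, k, l}" "Re z = real v"
    by auto
  then have "Im z = 0"
    using im1 im2 by (auto split: if_splits)
  moreover have "v < n"
    using v assms by auto
  ultimately show "z \<in> vertex_points n (book c)"
    using v by (auto simp: vertex_points_book complex_eq_iff)
qed

text \<open>Equating the two quadratics cancels the squares and leaves a linear equation with root
  \<open>x\<close>. Alternation makes its slope positive and puts the root strictly between
  \<open>k\<close> and \<open>j\<close>, so the meeting point is unique and off the spine.\<close>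

lemma parabolas_linked:
  assumes "i < k" "k < j" "j < l" "c i j = c k l"
  shows "\<exists>z. edge_image (book c) (i, j) \<inter> edge_image (book c) (k, l) - vertex_points n (book c) = {z}"
proof -
  define x where "x = (real k * real l - real i * real j) / (real k + real l - real i - real j)"
  have pos: "real k + real l - real i - real j > 0"
    using assms by linarith
  have uniq: "(y - real i) * (real j - y) = (y - real k) * (real l - y) \<longleftrightarrow> y = x" for y
    unfolding x_def using pos by (simp add: field_simps) argo
  have "k < x"
  proof -
    have "(real k - real i) * (real j - real k) > 0"
      using assms by simp
    then show ?thesis
      unfolding x_def using pos by (simp add: field_simps)
  qed
  have "x < j"
  proof -
    have "(real j - real k) * (real l - real j) > 0"
      using assms by simp
    then show ?thesis
      unfolding x_def using pos by (simp add: field_simps)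
  qed
  define z where "z = parabola (c i j) i j x"
  have "i < j" "k < l"
    using assms by auto
  have "z \<in> edge_image (book c) (i, j)" "z \<in> edge_image (book c) (k, l)"
    using \<open>k < x\<close> \<open>x < j\<close> assms uniq[of x]
    by (auto simp: z_def edge_image_book_iff[OF \<open>i < j\<close>] edge_image_book_iff[OF \<open>k < l\<close>] parabola_def)
  moreover have "z \<notin> vertex_points n (book c)"
  proof -
    have "(x - real i) * (real j - x) > 0"
      using \<open>k < x\<close> \<open>x < j\<close> assms by auto
    then have "Im z \<noteq> 0"
      by (auto simp: z_def parabola_def)
    then show ?thesis
      by (auto simp: vertex_points_book)
  qed
  moreover have "w = z"
    if "w \<in> edge_image (book c) (i, j)" "w \<in> edge_image (book c) (k, l)" for w
  proof -
    have "Re w = x"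
      using that assms uniq[of "Re w"]
      by (auto simp: edge_image_book_iff[OF \<open>i < j\<close>] edge_image_book_iff[OF \<open>k < l\<close>] split: if_splits)
    then show ?thesis
      using that by (auto simp: z_def edge_image_book_iff[OF \<open>i < j\<close>] parabola_def complex_eq_iff)
  qed
  ultimately show ?thesis
    by blast
qed

lemma card_crossing_points:
  assumes "i < j" "k < l" "j < n" "l < n" "(i, j) \<noteq> (k, l)"
  shows "card (edge_image (book c) (i, j) \<inter> edge_image (book c) (k, l) - vertex_points n (book c)) =
    (if crossing c i j k l then 1 else 0)"
proof (cases "crossing c i j k l")
  case True
  then have "c i j = c k l" and "i < k \<and> k < j \<and> j < l \<or> k < i \<and> i < l \<and> l < j"
    using assms by (auto simp: crossing_def linked_def min_def max_def)
  then have "\<exists>z. edge_image (book c) (i, j) \<inter> edge_image (book c) (k, l) - vertex_points n (book c) = {z}"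
    using parabolas_linked[of i k j l c n] parabolas_linked[of k i l j c n]
    by (metis Int_commute)
  then show ?thesis
    using True by auto
next
  case False
  then show ?thesis
    using parabolas_not_crossing[OF assms] by (metis Diff_eq_empty_iff card.empty)
qed

lemma finite_vertex_points: "finite (vertex_points n D)"
  by (simp add: vertex_points_def)

lemma finite_edge_intersection:
  assumes "i < j" "k < l" "j < n" "l < n" "(i, j) \<noteq> (k, l)"
  shows "finite (edge_image (book c) (i, j) \<inter> edge_image (book c) (k, l))"
proof (cases "crossing c i j k l")
  case True
  then have "finite (edge_image (book c) (i, j) \<inter> edge_image (book c) (k, l) - vertex_points n (book c))"
    using card_crossing_points[OF assms, of c] by (simp add: card_ge_0_finite)
  then show ?thesis
    by (simp add: finite_vertex_points)
next
  case False
  then show ?thesis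
    using parabolas_not_crossing[OF assms] finite_vertex_points by (metis finite_subset)
qed

lemma two_page_drawing_book: "two_page_drawing n (book c)"
  unfolding two_page_drawing_def
proof (intro conjI ballI impI)
  show "inj_on (fst (book c)) {..<n}"
    by (simp add: book_def inj_on_def)
next
  fix e assume "e \<in> kn_edges n"
  then obtain i j where e: "e = (i, j)" "i < j" "j < n"
    by (auto simp: kn_edges_def)
  have "path (snd (book c) i j)"
    unfolding path_def book_def parabola_def Complex_eq
    by (auto intro!: continuous_intros)
  moreover have "inj_on (snd (book c) i j) {0..1}"
    using e by (auto simp: inj_on_def book_def parabola_def)
  ultimately have "arc (snd (book c) i j)"
    by (simp add: arc_def)
  moreover have "pathstart (snd (book c) i j) = complex_of_real (fst (book c) i)"
    "pathfinish (snd (book c) i j) = complex_of_real (fst (book c) j)"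
    by (simp_all add: pathstart_def pathfinish_def book_def parabola_ends)
  moreover have "path_image (snd (book c) i j) = edge_image (book c) (i, j)"
    by (simp add: edge_image_def)
  moreover have "edge_image (book c) (i, j) \<subseteq> {z. 0 \<le> Im z} \<or>
      edge_image (book c) (i, j) \<subseteq> {z. Im z \<le> 0}"
    by (cases "c i j") (auto simp: edge_image_book_iff[OF e(2)])
  ultimately show "case e of (i, j) \<Rightarrow>
        arc (snd (book c) i j) \<and>
        pathstart (snd (book c) i j) = complex_of_real (fst (book c) i) \<and>
        pathfinish (snd (book c) i j) = complex_of_real (fst (book c) j) \<and>
        (path_image (snd (book c) i j) \<subseteq> {z. 0 \<le> Im z} \<or>
         path_image (snd (book c) i j) \<subseteq> {z. Im z \<le> 0}) \<and>
        path_image (snd (book c) i j) \<inter> vertex_points n (book c)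
          \<subseteq> {complex_of_real (fst (book c) i), complex_of_real (fst (book c) j)}"
    using edge_image_book_vertices[OF e(2,3), of c] e by (simp add: book_def)
next
  fix e f assume "e \<in> kn_edges n" "f \<in> kn_edges n" "e \<noteq> f"
  then show "finite (edge_image (book c) e \<inter> edge_image (book c) f)"
    using finite_edge_intersection[of "fst e" "snd e" "fst f" "snd f" n c]
    by (auto simp: kn_edges_def)
qed

section \<open>Crossings counted by quadruples of vertices\<close>

definition quads :: "nat \<Rightarrow> (nat \<times> nat \<times> nat \<times> nat) set" where
  "quads n = {(p, q, r, s). p < q \<and> q < r \<and> r < s \<and> s < n}"

lemma finite_quads: "finite (quads n)"
proof (rule finite_subset)
  show "quads n \<subseteq> {..<n} \<times> {..<n} \<times> {..<n} \<times> {..<n}"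
    by (auto simp: quads_def)
qed auto

text \<open>Of the three ways to split four vertices into two edges only first-third against
  second-fourth alternates. By \<open>card_crossing_points\<close> a pair of alternating edges
  contributes one point if the pages agree and none otherwise.\<close>

lemma crossings_book:
  "crossings n (book c) = card {(p, q, r, s) \<in> quads n. c p r = c q s}"
proof -
  let ?M = "{(p, q, r, s) \<in> quads n. c p r = c q s}"
  let ?pair = "\<lambda>(p, q, r, s). {(p, r), (q, s)} :: (nat \<times> nat) set"
  let ?pts = "\<lambda>P. (\<Inter>e \<in> P. edge_image (book c) e) - vertex_points n (book c)"
  let ?PP = "{P. P \<subseteq> kn_edges n \<and> card P = 2}"
  have fin: "finite (kn_edges n)"
    by (rule finite_subset[of _ "{..<n} \<times> {..<n}"]) (auto simp: kn_edges_def)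
  have inj: "inj_on ?pair (quads n)"
    by (auto simp: inj_on_def quads_def doubleton_eq_iff)
  have val: "card (?pts P) = (if P \<in> ?pair ` ?M then 1 else 0)" if P: "P \<in> ?PP" for P
  proof -
    obtain e f where ef: "P = {e, f}" "e \<noteq> f"
      using P by (auto simp: card_2_iff)
    obtain i j k l where ij: "e = (i, j)" "f = (k, l)"
      by (metis surj_pair)
    have *: "i < j" "k < l" "j < n" "l < n" "(i, j) \<noteq> (k, l)"
      using P ef ij by (auto simp: kn_edges_def)
    have "P \<in> ?pair ` ?M \<longleftrightarrow> crossing c i j k l"
    proof
      assume "P \<in> ?pair ` ?M"
      then obtain p q r s where "(p, q, r, s) \<in> ?M" "P = {(p, r), (q, s)}"
        by auto
      then show "crossing c i j k l"
        using ef ij by (auto simp: doubleton_eq_iff crossing_def linked_def quads_def)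
    next
      assume "crossing c i j k l"
      then have "(i, k, j, l) \<in> ?M \<or> (k, i, l, j) \<in> ?M"
        using * by (auto simp: crossing_def linked_def quads_def min_def max_def split: if_splits)
      then show "P \<in> ?pair ` ?M"
        using ef ij by (force simp: image_iff)
    qed
    then show ?thesis
      using card_crossing_points[OF *, of c] ef ij by simp
  qed
  have "?pair ` ?M \<subseteq> ?PP"
    by (auto simp: quads_def kn_edges_def card_2_iff)
  moreover have "finite ?PP"
    using fin by auto
  ultimately have "crossings n (book c) = card (?pair ` ?M)"
    unfolding crossings_def using val by (simp add: sum.If_cases Int_absorb1 inf_commute)
  also have "\<dots> = card ?M"
    by (rule card_image[OF inj_on_subset[OF inj]]) auto
  finally show ?thesis .
qed

section \<open>Vertex permutations induced by homeomorphisms\<close>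

definition edge_curve :: "(nat \<Rightarrow> nat \<Rightarrow> bool) \<Rightarrow> nat \<Rightarrow> nat \<Rightarrow> complex set" where
  "edge_curve c i j = edge_image (book c) (min i j, max i j)"

text \<open>Expresses crossings through point sets alone, a form that homeomorphisms respect. Equal
  pairs of ends must be excluded, since an edge meets itself away from the vertices.\<close>

lemma crossing_iff_edge_curves:
  assumes sym: "\<And>i j. c i j = c j i"
    and "i < n" "j < n" "k < n" "l < n" "i \<noteq> j" "k \<noteq> l"
  shows "crossing c i j k l \<longleftrightarrow> {i, j} \<noteq> {k, l} \<and>
    edge_curve c i j \<inter> edge_curve c k l - vertex_points n (book c) \<noteq> {}"
proof (cases "{i, j} = {k, l}")
  case True
  then show ?thesis
    by (auto simp: crossing_def linked_def doubleton_eq_iff)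
next
  case False
  have minmax: "c (min i j) (max i j) = c i j" for i j
    using sym by (simp add: min_def max_def)
  have *: "min i j < max i j" "min k l < max k l" "max i j < n" "max k l < n"
    "(min i j, max i j) \<noteq> (min k l, max k l)"
    using assms False by (auto simp: min_def max_def doubleton_eq_iff split: if_splits)
  have eq: "crossing c (min i j) (max i j) (min k l) (max k l) \<longleftrightarrow> crossing c i j k l"
    using * by (simp add: crossing_def linked_def minmax)
  show ?thesis
    using card_crossing_points[OF *, of c] parabolas_not_crossing[OF *, of c] False
    unfolding eq edge_curve_def by (metis Diff_eq_empty_iff card.empty zero_neq_one)
qed

text \<open>The vertex points are permuted. An edge curve contains no vertices besides its ends, so
  its image is the edge curve between the images of those ends, and common points off the vertices
  are carried along.\<close>

lemma homeomorphic_books_permutation: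
  assumes homeo: "homeomorphic_drawings n (book c1) (book c2)"
    and sym1: "\<And>i j. c1 i j = c1 j i" and sym2: "\<And>i j. c2 i j = c2 j i"
  obtains \<sigma> where "bij_betw \<sigma> {..<n} {..<n}"
    and "\<And>i j k l. i < n \<Longrightarrow> j < n \<Longrightarrow> k < n \<Longrightarrow> l < n \<Longrightarrow> i \<noteq> j \<Longrightarrow> k \<noteq> l \<Longrightarrow>
      crossing c1 i j k l \<longleftrightarrow> crossing c2 (\<sigma> i) (\<sigma> j) (\<sigma> k) (\<sigma> l)"
proof -
  let ?V = "(\<lambda>k. complex_of_real (real k)) ` {..<n}"
  let ?v = "\<lambda>k. complex_of_real (real k)"
  obtain h g where hg: "homeomorphism UNIV UNIV h g" and hV: "h ` ?V = ?V"
    and hE: "(\<lambda>A. h ` A) ` edge_images n (book c1) = edge_images n (book c2)"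
    using homeo unfolding homeomorphic_drawings_def vertex_points_book by blast
  have "inj h"
    using hg by (metis homeomorphism_apply1 injI UNIV_I)
  have "\<exists>j<n. h (?v i) = ?v j" if "i < n" for i
    using hV that by blast
  then obtain \<sigma> where \<sigma>: "\<And>i. i < n \<Longrightarrow> \<sigma> i < n \<and> h (?v i) = ?v (\<sigma> i)"
    by metis
  have inj: "inj_on \<sigma> {..<n}"
  proof (rule inj_onI)
    fix i j assume "i \<in> {..<n}" "j \<in> {..<n}" "\<sigma> i = \<sigma> j"
    then have "h (?v i) = h (?v j)"
      using \<sigma> by simp
    then show "i = j"
      using \<open>inj h\<close> by (simp add: inj_eq)
  qed
  moreover have "\<sigma> ` {..<n} \<subseteq> {..<n}"
    using \<sigma> by auto
  ultimately have bij: "bij_betw \<sigma> {..<n} {..<n}"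
    by (simp add: bij_betw_def endo_inj_surj)
  have curve: "h ` edge_curve c1 i j = edge_curve c2 (\<sigma> i) (\<sigma> j)"
    if "i < n" "j < n" "i \<noteq> j" for i j
  proof -
    have ij: "min i j < max i j" "max i j < n"
      using that by (auto simp: min_def max_def)
    then have "edge_curve c1 i j \<in> edge_images n (book c1)"
      unfolding edge_curve_def edge_images_def by (intro imageI) (simp add: kn_edges_def)
    then have "h ` edge_curve c1 i j \<in> edge_images n (book c2)"
      unfolding hE[symmetric] by (rule imageI)
    then obtain k l where kl: "k < l" "l < n" and img: "h ` edge_curve c1 i j = edge_image (book c2) (k, l)"
      unfolding edge_images_def by (auto simp: kn_edges_def)
    \<comment> \<open>Intersecting with the vertex set recovers the unordered pair of ends from a
      curve.\<close>
    have "h ` (edge_curve c1 i j \<inter> ?V) = edge_image (book c2) (k, l) \<inter> ?V"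
      using image_Int[OF \<open>inj h\<close>] img hV by simp
    then have "h ` {?v (min i j), ?v (max i j)} = {?v k, ?v l}"
      using edge_image_book_vertices[OF ij, of c1] edge_image_book_vertices[OF kl, of c2]
      by (simp add: edge_curve_def vertex_points_book)
    moreover have "h ` {?v (min i j), ?v (max i j)} = {?v (\<sigma> i), ?v (\<sigma> j)}"
      using \<sigma>[OF that(1)] \<sigma>[OF that(2)] by (auto simp: min_def max_def)
    ultimately have "\<sigma> i = k \<and> \<sigma> j = l \<or> \<sigma> i = l \<and> \<sigma> j = k"
      by (auto simp: doubleton_eq_iff)
    then show ?thesis
      using img kl by (auto simp: edge_curve_def)
  qed
  have "crossing c1 i j k l \<longleftrightarrow> crossing c2 (\<sigma> i) (\<sigma> j) (\<sigma> k) (\<sigma> l)"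
    if ijkl: "i < n" "j < n" "k < n" "l < n" "i \<noteq> j" "k \<noteq> l" for i j k l
  proof -
    have \<sigma>_eq: "\<sigma> x = \<sigma> y \<longleftrightarrow> x = y" if "x < n" "y < n" for x y
      using inj that by (auto simp: inj_on_def)
    have "h ` (edge_curve c1 i j \<inter> edge_curve c1 k l - ?V) =
        edge_curve c2 (\<sigma> i) (\<sigma> j) \<inter> edge_curve c2 (\<sigma> k) (\<sigma> l) - ?V"
      using image_set_diff[OF \<open>inj h\<close>] image_Int[OF \<open>inj h\<close>] curve ijkl hV by simp
    moreover have "{i, j} = {k, l} \<longleftrightarrow> {\<sigma> i, \<sigma> j} = {\<sigma> k, \<sigma> l}"
      using ijkl by (simp add: doubleton_eq_iff \<sigma>_eq)
    moreover have "\<sigma> i < n" "\<sigma> j < n" "\<sigma> k < n" "\<sigma> l < n" "\<sigma> i \<noteq> \<sigma> j" "\<sigma> k \<noteq> \<sigma> l"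
      using \<sigma> \<sigma>_eq ijkl by auto
    ultimately show ?thesis
      using crossing_iff_edge_curves[of c1, OF sym1 ijkl]
        crossing_iff_edge_curves[of c2 "\<sigma> i" n "\<sigma> j" "\<sigma> k" "\<sigma> l", OF sym2]
      unfolding vertex_points_book by (metis image_is_empty)
  qed
  with bij show thesis
    by (rule that)
qed

section \<open>The number of crossings\<close>

definition half :: "nat \<Rightarrow> nat \<Rightarrow> bool" where
  "half m s \<longleftrightarrow> s mod (2 * m + 1) \<le> m"

text \<open>Two distinct vertices below \<open>2 * m + 1\<close> with sum class \<open>0\<close> add
  up to exactly \<open>2 * m + 1\<close>. Such a free edge is named by its smaller end, and
  \<open>B\<close> lists those drawn on the upper page.\<close>

definition colouring :: "nat \<Rightarrow> nat set \<Rightarrow> nat \<Rightarrow> nat \<Rightarrow> bool" where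
  "colouring m B i j \<longleftrightarrow> (if i + j = 2 * m + 1 then min i j \<in> B else half m (i + j))"

lemma half_periodic: "half m (s + (2 * m + 1)) = half m s"
  unfolding half_def by (simp only: mod_add_self2)

lemma half_small: "s < 2 * m + 1 \<Longrightarrow> half m s \<longleftrightarrow> s \<le> m"
  by (simp add: half_def)

lemma half_large:
  assumes "2 * m + 1 \<le> s" "s < 2 * (2 * m + 1)"
  shows "half m s \<longleftrightarrow> s \<le> 3 * m + 1"
proof -
  have "half m s = half m (s - (2 * m + 1))"
    using half_periodic[of m "s - (2 * m + 1)"] assms by simp
  also have "\<dots> \<longleftrightarrow> s - (2 * m + 1) \<le> m"
    using assms by (intro half_small) auto
  finally show ?thesis
    using assms by auto
qed

lemma colouring_small: "i + j < 2 * m + 1 \<Longrightarrow> colouring m B i j \<longleftrightarrow> i + j \<le> m"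
  by (simp add: colouring_def half_small)

lemma colouring_free: "i + j = 2 * m + 1 \<Longrightarrow> colouring m B i j \<longleftrightarrow> min i j \<in> B"
  by (simp add: colouring_def)

lemma colouring_large:
  "2 * m + 1 < i + j \<Longrightarrow> i + j < 2 * (2 * m + 1) \<Longrightarrow> colouring m B i j \<longleftrightarrow> i + j \<le> 3 * m + 1"
  by (simp add: colouring_def half_large)

definition monochromatic :: "nat \<Rightarrow> nat set \<Rightarrow> (nat \<times> nat \<times> nat \<times> nat) set" where
  "monochromatic m B = {(p, q, r, s) \<in> quads (2 * m + 1). colouring m B p r = colouring m B q s}"

definition free_quads :: "nat \<Rightarrow> (nat \<times> nat \<times> nat \<times> nat) set" where
  "free_quads m = {(p, q, r, s) \<in> quads (2 * m + 1). p + r = 2 * m + 1 \<or> q + s = 2 * m + 1}"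

text \<open>The reflection keeps every free edge and flips the page of all others. As
  \<open>p + r < q + s\<close>, exactly one of the two alternating edges is free, so the reflection
  exchanges monochromatic and non-monochromatic quadruples.\<close>

lemma card_monochromatic_free: "2 * card (monochromatic m B \<inter> free_quads m) = card (free_quads m)"
proof -
  define n where "n = 2 * m + 1"
  \<comment> \<open>Vertex \<open>0\<close> is fixed while the order of the others is reversed, so
    the image is listed increasingly again; alternating edges go to alternating edges.\<close>
  define refl :: "nat \<times> nat \<times> nat \<times> nat \<Rightarrow> nat \<times> nat \<times> nat \<times> nat" where
    "refl = (\<lambda>(p, q, r, s). if p = 0 then (0, n - s, n - r, n - q) else (n - s, n - r, n - q, n - p))"
  have key: "refl x \<in> free_quads m \<and> refl (refl x) = x \<and>
      (refl x \<in> monochromatic m B \<longleftrightarrow> x \<notin> monochromatic m B)"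
    if x: "x \<in> free_quads m" for x
  proof -
    obtain p q r s where x_eq: "x = (p, q, r, s)"
      by (metis prod.exhaust)
    have ord: "p < q" "q < r" "r < s" "s < n" and free: "p + r = n \<or> q + s = n"
      using x by (auto simp: x_eq free_quads_def quads_def n_def)
    consider (a) "p = 0" "q + s = n" | (b) "p > 0" "p + r = n" | (c) "p > 0" "q + s = n"
      using free ord by fastforce
    then show ?thesis
    proof cases
      case a
      then have eq: "n - s = q" "n - q = s" by auto
      have "colouring m B q s = (q \<in> B)"
        using a ord by (simp add: colouring_free n_def)
      moreover have "colouring m B 0 r = (r \<le> m)" "colouring m B 0 (n - r) = (n - r \<le> m)"
        using a ord by (subst colouring_small; auto simp: n_def)+
      ultimately show ?thesis
        using a ord eq
        by (auto simp: x_eq refl_def free_quads_def monochromatic_def quads_def n_def)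
    next
      case b
      then have eq: "n - p = r" "n - r = p" by auto
      have "colouring m B p r = (p \<in> B)"
        using b ord by (simp add: colouring_free n_def)
      moreover have "colouring m B q s = (q + s \<le> 3 * m + 1)"
        using b ord by (subst colouring_large; auto simp: n_def)
      moreover have "colouring m B (n - s) (n - q) = (n - s + (n - q) \<le> m)"
        using b ord by (subst colouring_small; auto simp: n_def)
      ultimately show ?thesis
        using b ord eq
        by (auto simp: x_eq refl_def free_quads_def monochromatic_def quads_def n_def)
    next
      case c
      then have eq: "n - q = s" "n - s = q" by auto
      have "colouring m B q s = (q \<in> B)"
        using c ord by (simp add: colouring_free n_def)
      moreover have "colouring m B p r = (p + r \<le> m)"
        using c ord by (subst colouring_small; auto simp: n_def)
      moreover have "colouring m B (n - r) (n - p) = (n - r + (n - p) \<le> 3 * m + 1)"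
        using c ord by (subst colouring_large; auto simp: n_def)
      ultimately show ?thesis
        using c ord eq
        by (auto simp: x_eq refl_def free_quads_def monochromatic_def quads_def n_def)
    qed
  qed
  have fin: "finite (free_quads m)"
    by (rule finite_subset[OF _ finite_quads[of n]]) (auto simp: free_quads_def n_def)
  have "bij_betw refl (monochromatic m B \<inter> free_quads m) (free_quads m - monochromatic m B)"
    by (rule bij_betw_byWitness[where f' = refl]) (use key in auto)
  then have "card (monochromatic m B \<inter> free_quads m) = card (free_quads m - monochromatic m B)"
    by (rule bij_betw_same_card)
  moreover have "card (free_quads m) =
      card (free_quads m \<inter> monochromatic m B) + card (free_quads m - monochromatic m B)"
    using fin by (simp add: card_Int_Diff)
  ultimately show ?thesis
    by (simp add: Int_commute)
qed

text \<open>Quadruples without a free alternating edge do not see \<open>B\<close>; of the others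
  exactly half are monochromatic by \<open>card_monochromatic_free\<close>.\<close>

lemma card_monochromatic_indep: "card (monochromatic m B) = card (monochromatic m B')"
proof -
  have fin: "finite (monochromatic m B)" for B
    by (rule finite_subset[OF _ finite_quads[of "2 * m + 1"]]) (auto simp: monochromatic_def)
  have "monochromatic m B - free_quads m = monochromatic m B' - free_quads m"
    by (auto simp: monochromatic_def free_quads_def colouring_def)
  then show ?thesis
    using card_Int_Diff[OF fin, of B "free_quads m"] card_Int_Diff[OF fin, of B' "free_quads m"]
      card_monochromatic_free[of m B] card_monochromatic_free[of m B'] by simp
qed

section \<open>Averaging over the rotations\<close>

lemma sum_periodic_shift:
  fixes f :: "nat \<Rightarrow> 'a::ab_group_add"
  assumes "\<And>a. f (a + n) = f a"
  shows "(\<Sum>a<n. f (a + u)) = (\<Sum>a<n. f a)"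
proof (induction u)
  case (Suc u)
  have "f u + (\<Sum>a<n. f (a + Suc u)) = (\<Sum>a<n. f (a + u)) + f (n + u)"
    using sum.lessThan_Suc_shift[of "\<lambda>a. f (a + u)" n] by simp
  moreover have "f (n + u) = f u"
    using assms[of u] by (simp add: add.commute)
  ultimately show ?case
    using Suc by simp
qed simp

text \<open>The residues split into cyclic arcs of lengths \<open>m + 1\<close> and
  \<open>m\<close>. As \<delta> is at most \<open>m\<close>, the values at \<open>a\<close> and
  \<open>a + \<delta>\<close> differ exactly when \<open>a\<close> is among the last \<delta>
  elements of its arc.\<close>

lemma half_agreements:
  assumes "\<delta> \<le> m"
  shows "(\<Sum>a<2 * m + 1. of_bool (half m a = half m (a + \<delta>)) :: int) = 2 * int m + 1 - 2 * int \<delta>"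
proof -
  let ?n = "2 * m + 1"
  have "{a. a < ?n \<and> half m a \<noteq> half m (a + \<delta>)} = {m + 1 - \<delta>..<m + 1} \<union> {?n - \<delta>..<?n}"
  proof (intro set_eqI)
    fix a
    show "a \<in> {a. a < ?n \<and> half m a \<noteq> half m (a + \<delta>)} \<longleftrightarrow>
        a \<in> {m + 1 - \<delta>..<m + 1} \<union> {?n - \<delta>..<?n}"
    proof (cases "a + \<delta> < ?n")
      case True
      then show ?thesis
        using assms by (auto simp: half_small)
    next
      case False
      then show ?thesis
        using assms half_large[of m "a + \<delta>"] by (auto simp: half_small)
    qed
  qed
  moreover have "card ({m + 1 - \<delta>..<m + 1} \<union> {?n - \<delta>..<?n}) = 2 * \<delta>"
    using assms by (subst card_Un_disjoint) auto
  ultimately have "card {a. a < ?n \<and> half m a \<noteq> half m (a + \<delta>)} = 2 * \<delta>"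
    by simp
  moreover have "{..<?n} \<inter> {a. half m a \<noteq> half m (a + \<delta>)} = {a. a < ?n \<and> half m a \<noteq> half m (a + \<delta>)}"
    by auto
  ultimately have "(\<Sum>a<?n. of_bool (half m a \<noteq> half m (a + \<delta>)) :: int) = 2 * int \<delta>"
    by (simp add: sum_of_bool_eq del: sum.lessThan_Suc)
  moreover have "(\<Sum>a<?n. of_bool (half m a = half m (a + \<delta>)) :: int) +
      (\<Sum>a<?n. of_bool (half m a \<noteq> half m (a + \<delta>)) :: int) = (\<Sum>a<?n. 1)"
    unfolding sum.distrib[symmetric] by (intro sum.cong) auto
  ultimately show ?thesis
    by simp
qed

text \<open>Sum class \<open>0\<close> follows \<open>half\<close> too, so that the family in
  \<open>a\<close> is closed under rotation; \<open>a = 0\<close> is the colouring with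
  \<open>B = UNIV\<close>.\<close>

definition rotated_count :: "nat \<Rightarrow> nat \<Rightarrow> nat" where
  "rotated_count m a = card {(p, q, r, s) \<in> quads (2 * m + 1). half m (a + (p + r)) = half m (a + (q + s))}"

lemma rotated_count_0: "rotated_count m 0 = card (monochromatic m UNIV)"
proof -
  have "colouring m UNIV i j = half m (i + j)" for i j
    by (simp add: colouring_def half_def)
  then show ?thesis
    by (simp add: rotated_count_def monochromatic_def)
qed

lemma rotated_count_periodic: "rotated_count m (a + (2 * m + 1)) = rotated_count m a"
proof -
  have "half m (a + (2 * m + 1) + t) = half m (a + t)" for t
    using half_periodic[of m "a + t"] by (simp add: ac_simps)
  then show ?thesis
    unfolding rotated_count_def by presburger
qed

text \<open>Moving every vertex one step around preserves alternation and raises every edge sum by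
  two modulo \<open>2 * m + 1\<close>.\<close>

lemma rotated_count_add2: "rotated_count m (a + 2) = rotated_count m a"
proof -
  define n where "n = 2 * m + 1"
  define M where "M a = {(p, q, r, s) \<in> quads n. half m (a + (p + r)) = half m (a + (q + s))}" for a
  \<comment> \<open>A last vertex \<open>n - 1\<close> wraps to \<open>0\<close> and becomes the
    first, so the two alternating edges then swap their places in the quadruple.\<close>
  define rot :: "nat \<times> nat \<times> nat \<times> nat \<Rightarrow> nat \<times> nat \<times> nat \<times> nat" where
    "rot = (\<lambda>(p, q, r, s). if s + 1 = n then (0, p + 1, q + 1, r + 1) else (p + 1, q + 1, r + 1, s + 1))"
  define tor :: "nat \<times> nat \<times> nat \<times> nat \<Rightarrow> nat \<times> nat \<times> nat \<times> nat" where
    "tor = (\<lambda>(p, q, r, s). if p = 0 then (q - 1, r - 1, s - 1, n - 1) else (p - 1, q - 1, r - 1, s - 1))"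
  have per: "half m (t + n) = half m t" for t
    using half_periodic n_def by simp
  have rot: "rot x \<in> quads n \<and> tor (rot x) = x \<and> (rot x \<in> M a \<longleftrightarrow> x \<in> M (a + 2))"
    if x: "x \<in> quads n" for x
  proof -
    obtain p q r s where x_eq: "x = (p, q, r, s)"
      by (metis prod.exhaust)
    have ord: "p < q" "q < r" "r < s" "s < n"
      using x by (auto simp: x_eq quads_def)
    show ?thesis
    proof (cases "s + 1 = n")
      case True
      have "half m (a + 2 + (q + s)) = half m (a + (0 + (q + 1)))"
      proof -
        have "a + 2 + (q + s) = a + (0 + (q + 1)) + n"
          using True by simp
        then show ?thesis
          by (simp only: per)
      qed
      then show ?thesis
        using ord True by (auto simp: x_eq rot_def tor_def quads_def M_def)
    next
      case False
      then show ?thesis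
        using ord by (auto simp: x_eq rot_def tor_def quads_def M_def)
    qed
  qed
  have tor: "tor x \<in> quads n \<and> rot (tor x) = x" if "x \<in> quads n" for x
    using that by (auto simp: rot_def tor_def quads_def split: if_splits)
  have "bij_betw rot (M (a + 2)) (M a)"
  proof (rule bij_betw_byWitness[where f' = tor])
    have sub: "M a \<subseteq> quads n" for a by (auto simp: M_def)
    show "\<forall>x\<in>M (a + 2). tor (rot x) = x" "\<forall>x\<in>M a. rot (tor x) = x"
      using rot tor sub by blast+
    show "rot ` M (a + 2) \<subseteq> M a"
      using rot sub by blast
    show "tor ` M a \<subseteq> M (a + 2)"
    proof
      fix y assume "y \<in> tor ` M a"
      then obtain x where x: "x \<in> M a" "y = tor x" by blast
      then have "y \<in> quads n" "rot y = x"
        using tor sub by blast+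
      then show "y \<in> M (a + 2)"
        using rot x by blast
    qed
  qed
  then have "card (M (a + 2)) = card (M a)"
    by (rule bij_betw_same_card)
  then show ?thesis
    by (simp add: rotated_count_def M_def n_def)
qed

text \<open>Steps of two reach every residue because the modulus is odd: odd shifts are linked to
  \<open>1 + 2 * m\<close>, a full period.\<close>

lemma rotated_count_const: "rotated_count m a = rotated_count m 0"
proof -
  have even: "rotated_count m (b + 2 * k) = rotated_count m b" for b k
  proof (induction k)
    case (Suc k)
    then show ?case
      using rotated_count_add2[of m "b + 2 * k"] by simp
  qed simp
  show ?thesis
  proof (cases "even a")
    case True
    then obtain k where "a = 2 * k" by (elim evenE)
    then show ?thesis using even[of 0 k] by simp
  next
    case False
    then obtain k where "a = 2 * k + 1" by (elim oddE)
    then have "rotated_count m a = rotated_count m 1"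
      using even[of 1 k] by (simp add: add.commute)
    also have "\<dots> = rotated_count m (1 + 2 * m)"
      using even[of 1 m] by simp
    also have "\<dots> = rotated_count m 0"
      using rotated_count_periodic[of m 0] by (simp add: add.commute)
    finally show ?thesis .
  qed
qed

text \<open>With \<open>x = q - p\<close> and \<open>t = s - \<delta>\<close> the equation forces
  \<open>r = t + x\<close>, and the order becomes \<open>1 \<le> x < \<delta>\<close> together with
  \<open>p < t < n - \<delta>\<close>. Hence \<open>x\<close> and the pair \<open>(t, p)\<close>
  vary independently.\<close>

lemma card_quads_diff:
  assumes "0 < \<delta>" "\<delta> < n"
  shows "2 * int (card {(p, q, r, s) \<in> quads n. q + s = p + r + \<delta>}) =
    (int \<delta> - 1) * ((int n - int \<delta>) * (int n - int \<delta> - 1))"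
proof -
  let ?T = "Sigma {..<n - \<delta>} (\<lambda>t. {..<t})"
  have "bij_betw (\<lambda>(x, t, p). (p, p + x, t + x, t + \<delta>)) ({1..<\<delta>} \<times> ?T)
      {(p, q, r, s) \<in> quads n. q + s = p + r + \<delta>}"
  proof (rule bij_betw_byWitness[where f' = "\<lambda>(p, q, r, s). (q - p, s - \<delta>, p)"])
    show "\<forall>x\<in>{1..<\<delta>} \<times> ?T. (case case x of (x, t, p) \<Rightarrow> (p, p + x, t + x, t + \<delta>) of
        (p, q, r, s) \<Rightarrow> (q - p, s - \<delta>, p)) = x"
      by auto
    show "(\<lambda>(x, t, p). (p, p + x, t + x, t + \<delta>)) ` ({1..<\<delta>} \<times> ?T) \<subseteq>
        {(p, q, r, s) \<in> quads n. q + s = p + r + \<delta>}"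
      by (auto simp: quads_def)
    have *: "p + (q - p) = q \<and> s - \<delta> + (q - p) = r \<and> s - \<delta> + \<delta> = s \<and>
        1 \<le> q - p \<and> q - p < \<delta> \<and> s - \<delta> < n - \<delta> \<and> p < s - \<delta>"
      if "p < q" "q < r" "r < s" "s < n" "q + s = p + r + \<delta>" for p q r s
      using that by linarith
    show "\<forall>x\<in>{(p, q, r, s) \<in> quads n. q + s = p + r + \<delta>}.
        (case case x of (p, q, r, s) \<Rightarrow> (q - p, s - \<delta>, p) of
          (x, t, p) \<Rightarrow> (p, p + x, t + x, t + \<delta>)) = x"
    proof
      fix x assume "x \<in> {(p, q, r, s) \<in> quads n. q + s = p + r + \<delta>}"
      then obtain p q r s where x: "x = (p, q, r, s)"
        and "p < q" "q < r" "r < s" "s < n" "q + s = p + r + \<delta>"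
        by (auto simp: quads_def)
      then show "(case case x of (p, q, r, s) \<Rightarrow> (q - p, s - \<delta>, p) of
          (x, t, p) \<Rightarrow> (p, p + x, t + x, t + \<delta>)) = x"
        unfolding x using *[of p q r s] by simp
    qed
    show "(\<lambda>(p, q, r, s). (q - p, s - \<delta>, p)) ` {(p, q, r, s) \<in> quads n. q + s = p + r + \<delta>} \<subseteq>
        {1..<\<delta>} \<times> ?T"
    proof (rule image_subsetI)
      fix x assume "x \<in> {(p, q, r, s) \<in> quads n. q + s = p + r + \<delta>}"
      then obtain p q r s where x: "x = (p, q, r, s)"
        and "p < q" "q < r" "r < s" "s < n" "q + s = p + r + \<delta>"
        by (auto simp: quads_def)
      then show "(case x of (p, q, r, s) \<Rightarrow> (q - p, s - \<delta>, p)) \<in> {1..<\<delta>} \<times> ?T"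
        unfolding x using *[of p q r s] by simp
    qed
  qed
  then have "card {(p, q, r, s) \<in> quads n. q + s = p + r + \<delta>} = card ({1..<\<delta>} \<times> ?T)"
    by (rule bij_betw_same_card[symmetric])
  also have "\<dots> = (\<delta> - 1) * (\<Sum>t<n - \<delta>. t)"
    by (simp add: card_cartesian_product)
  finally have "card {(p, q, r, s) \<in> quads n. q + s = p + r + \<delta>} = (\<delta> - 1) * (\<Sum>t<n - \<delta>. t)" .
  then have "2 * int (card {(p, q, r, s) \<in> quads n. q + s = p + r + \<delta>}) =
      int (\<delta> - 1) * (2 * int (\<Sum>t<n - \<delta>. t))"
    by (simp only: of_nat_mult mult.left_commute)
  also have "2 * int (\<Sum>t<N. t) = int N * (int N - 1)" for N
    by (induction N) (auto simp: algebra_simps)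
  finally show ?thesis
    using assms by (simp add: of_nat_diff)
qed

lemma telescoped_sum:
  fixes n :: int
  shows "2 * (\<Sum>\<delta> = 1..k. (int \<delta> - 1) * (n - int \<delta> - 1) * (n - 2 * int \<delta>)) =
    int k * (int k - 1) * ((n - int k - 1) * (n - int k - 2))"
  by (induction k) (simp_all add: algebra_simps)

text \<open>All rotated counts agree, so \<open>n\<close> times the count sums, over quadruples, the
  number of rotations that put both alternating edges on one page. This number depends only on the
  difference \<delta> of the edge sums, and \<open>card_quads_diff\<close> tells how often each
  \<delta> occurs.\<close>

lemma card_monochromatic: "4 * card (monochromatic m B) = m\<^sup>2 * (m - 1)\<^sup>2"
proof -
  define n where "n = 2 * m + 1"
  define N where "N = card (monochromatic m B)"
  define agree where "agree \<delta> = (\<Sum>a<n. of_bool (half m a = half m (a + \<delta>)) :: int)" for \<delta>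
  define L where "L \<delta> = int (card {(p, q, r, s) \<in> quads n. q + s = p + r + \<delta>})" for \<delta>
  have fin: "finite (quads n)" by (rule finite_quads)
  have per: "half m (t + n) = half m t" for t
    using half_periodic n_def by simp
  have shift: "(\<Sum>a<n. of_bool (half m (a + u) = half m (a + (u + \<delta>))) :: int) = agree \<delta>" for u \<delta>
  proof -
    have "half m (t + n + \<delta>) = half m (t + \<delta>)" for t
      using per[of "t + \<delta>"] by (simp add: ac_simps)
    then show ?thesis
      unfolding agree_def
      using sum_periodic_shift[of "\<lambda>a. of_bool (half m a = half m (a + \<delta>)) :: int" n u]
      by (simp only: per add.assoc simp_thms)
  qed
  have rc: "int (rotated_count m a) =
      (\<Sum>(p, q, r, s)\<in>quads n. of_bool (half m (a + (p + r)) = half m (a + (q + s))))" for a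
  proof -
    have "{(p, q, r, s) \<in> quads n. half m (a + (p + r)) = half m (a + (q + s))} =
        quads n \<inter> {x. case x of (p, q, r, s) \<Rightarrow> half m (a + (p + r)) = half m (a + (q + s))}"
      by auto
    then show ?thesis
      unfolding rotated_count_def n_def[symmetric]
      using fin by (simp add: sum_of_bool_eq case_prod_unfold)
  qed
  have "int n * int N = (\<Sum>a<n. int (rotated_count m a))"
    using rotated_count_const rotated_count_0 card_monochromatic_indep[of m B UNIV]
    by (simp add: N_def)
  also have "\<dots> = (\<Sum>a<n. \<Sum>(p, q, r, s)\<in>quads n. of_bool (half m (a + (p + r)) = half m (a + (q + s))))"
    by (simp add: rc)
  also have "\<dots> = (\<Sum>x\<in>quads n. \<Sum>a<n. case x of (p, q, r, s) \<Rightarrow> of_bool (half m (a + (p + r)) = half m (a + (q + s))))"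
    by (rule sum.swap)
  also have "\<dots> = (\<Sum>(p, q, r, s)\<in>quads n. agree (q + s - (p + r)))"
  proof (intro sum.cong refl, clarify)
    fix p q r s assume "(p, q, r, s) \<in> quads n"
    then have "q + s = p + r + (q + s - (p + r))"
      by (auto simp: quads_def)
    then show "(\<Sum>a<n. of_bool (half m (a + (p + r)) = half m (a + (q + s)))) = agree (q + s - (p + r))"
      using shift[of "p + r" "q + s - (p + r)"] by simp
  qed
  also have "\<dots> = (\<Sum>\<delta>\<in>{1..<n}. \<Sum>x\<in>{x \<in> quads n. (case x of (p, q, r, s) \<Rightarrow> q + s - (p + r)) = \<delta>}.
      case x of (p, q, r, s) \<Rightarrow> agree (q + s - (p + r)))"
  proof (rule sum.group[symmetric])
    show "(\<lambda>(p, q, r, s). q + s - (p + r)) ` quads n \<subseteq> {1..<n}"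
      by (auto simp: quads_def)
  qed (simp_all add: fin)
  also have "\<dots> = (\<Sum>\<delta>\<in>{1..<n}. L \<delta> * agree \<delta>)"
  proof (intro sum.cong refl)
    fix \<delta> assume \<delta>: "\<delta> \<in> {1..<n}"
    have "{x \<in> quads n. (case x of (p, q, r, s) \<Rightarrow> q + s - (p + r)) = \<delta>} =
        {(p, q, r, s) \<in> quads n. q + s = p + r + \<delta>}"
      using \<delta> by (auto simp: quads_def)
    moreover have "(\<Sum>x\<in>{(p, q, r, s) \<in> quads n. q + s = p + r + \<delta>}.
        case x of (p, q, r, s) \<Rightarrow> agree (q + s - (p + r))) =
        (\<Sum>x\<in>{(p, q, r, s) \<in> quads n. q + s = p + r + \<delta>}. agree \<delta>)"
      by (intro sum.cong) auto
    ultimately show "(\<Sum>x\<in>{x \<in> quads n. (case x of (p, q, r, s) \<Rightarrow> q + s - (p + r)) = \<delta>}.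
        case x of (p, q, r, s) \<Rightarrow> agree (q + s - (p + r))) = L \<delta> * agree \<delta>"
      by (simp add: L_def)
  qed
  also have "\<dots> = (\<Sum>\<delta>=1..m. L \<delta> * agree \<delta>) + (\<Sum>\<delta>=m+1..2*m. L \<delta> * agree \<delta>)"
  proof -
    have "{1..<n} = {1..m} \<union> {m + 1..2 * m}"
      by (auto simp: n_def)
    then show ?thesis
      by (simp add: sum.union_disjoint)
  qed
  \<comment> \<open>\<open>half_agreements\<close> covers only differences up to \<open>m\<close>; a
    larger one is paired with its complement to \<open>n\<close>, which has the same number of
    agreements.\<close>
  also have "(\<Sum>\<delta>=m+1..2*m. L \<delta> * agree \<delta>) = (\<Sum>\<delta>=1..m. L (n - \<delta>) * agree (n - \<delta>))"
    by (rule sum.reindex_bij_witness[where i = "\<lambda>\<delta>. n - \<delta>" and j = "\<lambda>\<delta>. n - \<delta>"]) (auto simp: n_def)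
  finally have "2 * (int n * int N) =
      (\<Sum>\<delta>=1..m. 2 * L \<delta> * agree \<delta> + 2 * L (n - \<delta>) * agree (n - \<delta>))"
    by (simp add: sum.distrib sum_distrib_left mult.assoc)
  also have "\<dots> = (\<Sum>\<delta>=1..m. int n * ((int \<delta> - 1) * (int n - int \<delta> - 1) * (int n - 2 * int \<delta>)))"
  proof (intro sum.cong refl)
    fix \<delta> assume "\<delta> \<in> {1..m}"
    then have \<delta>: "0 < \<delta>" "\<delta> \<le> m" "\<delta> < n" "0 < n - \<delta>" "n - \<delta> < n"
      by (auto simp: n_def)
    have 1: "agree \<delta> = int n - 2 * int \<delta>"
      using half_agreements[OF \<delta>(2)] by (simp add: agree_def n_def)
    have "agree (n - \<delta>) = (\<Sum>a<n. of_bool (half m (a + \<delta>) = half m (a + (\<delta> + (n - \<delta>)))))"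
      by (rule shift[symmetric])
    also have "\<dots> = agree \<delta>"
      unfolding agree_def using \<delta> per by (intro sum.cong) auto
    finally have 2: "agree (n - \<delta>) = int n - 2 * int \<delta>"
      using 1 by simp
    have 3: "2 * L \<delta> = (int \<delta> - 1) * ((int n - int \<delta>) * (int n - int \<delta> - 1))"
      unfolding L_def by (rule card_quads_diff[OF \<delta>(1,3)])
    have 4: "2 * L (n - \<delta>) = (int n - int \<delta> - 1) * (int \<delta> * (int \<delta> - 1))"
      unfolding L_def using card_quads_diff[OF \<delta>(4,5)] \<delta> by (simp add: of_nat_diff)
    \<comment> \<open>The two counts share \<open>(\<delta> - 1) * (n - \<delta> - 1)\<close>; the
      remaining factors \<open>n - \<delta>\<close> and \<open>\<delta>\<close> add up to
      \<open>n\<close>, which later cancels against the number of rotations.\<close>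
    show "2 * L \<delta> * agree \<delta> + 2 * L (n - \<delta>) * agree (n - \<delta>) =
        int n * ((int \<delta> - 1) * (int n - int \<delta> - 1) * (int n - 2 * int \<delta>))"
      unfolding 1 2 3 4 by (simp add: algebra_simps)
  qed
  also have "2 * \<dots> = int n * (int m * (int m - 1) * ((int n - int m - 1) * (int n - int m - 2)))"
    using telescoped_sum[of "int n" m] by (simp add: sum_distrib_left[symmetric])
  finally have "int n * (4 * int N) = int n * (int m * (int m - 1) * (int m * (int m - 1)))"
    by (simp add: n_def)
  then have "4 * int N = (int m * (int m - 1))\<^sup>2"
    by (simp add: n_def power2_eq_square)
  \<comment> \<open>At \<open>m = 0\<close> the truncated \<open>m - 1\<close> differs from the
    integer one, but there the factor \<open>m\<close> vanishes.\<close>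
  also have "\<dots> = int (m\<^sup>2 * (m - 1)\<^sup>2)"
    by (cases m) (simp_all add: power_mult_distrib)
  finally show ?thesis
    unfolding N_def by linarith
qed

section \<open>Rigidity\<close>

definition nxt :: "nat \<Rightarrow> nat \<Rightarrow> nat" where
  "nxt n u = (if u + 1 = n then 0 else u + 1)"

definition adjacent :: "nat \<Rightarrow> nat \<Rightarrow> nat \<Rightarrow> bool" where
  "adjacent n u v \<longleftrightarrow> v = nxt n u \<or> u = nxt n v"

definition chord :: "nat \<Rightarrow> nat \<Rightarrow> nat \<Rightarrow> bool" where
  "chord n u v \<longleftrightarrow> u < n \<and> v < n \<and> u \<noteq> v \<and> \<not> adjacent n u v"

lemma nxt_less: "u < n \<Longrightarrow> nxt n u < n"
  by (auto simp: nxt_def)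

lemma nxt_inj: "u < n \<Longrightarrow> v < n \<Longrightarrow> nxt n u = nxt n v \<longleftrightarrow> u = v"
  by (auto simp: nxt_def)

lemma nxt_surj:
  assumes "v < n"
  obtains u where "u < n" "nxt n u = v"
proof (cases v)
  case 0
  then show thesis
    using that[of "n - 1"] assms by (simp add: nxt_def)
next
  case (Suc u)
  then show thesis
    using that[of u] assms by (simp add: nxt_def)
qed

lemma nxt_mod: "u < n \<Longrightarrow> nxt n u = (u + 1) mod n"
  by (auto simp: nxt_def)

lemma nxt_sum_mod:
  assumes "u < n" "v < n"
  shows "(nxt n u + nxt n v) mod n = ((u + v) mod n + 2) mod n"
proof -
  have "(nxt n u + nxt n v) mod n = ((u + 1) + (v + 1)) mod n"
    unfolding nxt_mod[OF assms(1)] nxt_mod[OF assms(2)] by (rule mod_add_eq)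
  then show ?thesis
    using mod_add_left_eq[of "u + v" n 2] by simp
qed

lemma linked_commute: "linked i j k l \<longleftrightarrow> linked k l i j"
  by (auto simp: linked_def)

lemma crossing_commute: "crossing c i j k l \<longleftrightarrow> crossing c k l i j"
  by (auto simp: crossing_def linked_commute)

text \<open>The ends of a chord are at least two steps apart both ways round, so the two moved ends
  land strictly inside different arcs between them.\<close>

lemma linked_nxt: "chord n u v \<Longrightarrow> linked u v (nxt n u) (nxt n v)"
  by (cases "u < v") (auto simp: chord_def adjacent_def nxt_def linked_def min_def max_def)

lemma crossing_nxt: "chord n u v \<Longrightarrow> crossing c u v (nxt n u) (nxt n v) \<longleftrightarrow> c u v = c (nxt n u) (nxt n v)"
  by (simp add: crossing_def linked_nxt)

text \<open>One side of a cycle edge contains no further vertex; this includes the edge joining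
  \<open>n - 1\<close> and \<open>0\<close>.\<close>

lemma adjacent_not_linked:
  assumes "u < n" "v < n" "k < n" "l < n" "adjacent n u v"
  shows "\<not> linked u v k l"
  using assms by (auto simp: adjacent_def nxt_def linked_def min_def max_def split: if_splits)

lemma chord_nxt:
  assumes "u < n" "v < n"
  shows "chord n (nxt n u) (nxt n v) \<longleftrightarrow> chord n u v"
  using assms by (auto simp: chord_def adjacent_def nxt_inj nxt_less)

lemma colouring_class:
  assumes "(i + j) mod (2 * m + 1) \<noteq> 0"
  shows "colouring m B i j \<longleftrightarrow> (i + j) mod (2 * m + 1) \<le> m"
proof -
  have "i + j \<noteq> 2 * m + 1"
    using assms by (metis mod_self)
  then show ?thesis
    by (simp add: colouring_def half_def)
qed

lemma mod_add2: "r < n \<Longrightarrow> 2 \<le> n \<Longrightarrow> (r + 2) mod n = (if r + 2 < n then r + 2 else r + 2 - n)" for n :: nat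
  by (simp add: le_mod_geq)

lemma mod_add_cancel_less:
  fixes a b k n :: nat
  assumes "a < n" "b < n" "(a + k) mod n = (b + k) mod n"
  shows "a = b"
  using assms
proof (induction a b rule: linorder_wlog)
  case (le a b)
  then have "n dvd (b + k) - (a + k)"
    by (metis add_le_cancel_right mod_eq_dvd_iff_nat)
  then show ?case
    using le by (auto dest: dvd_imp_le)
qed simp

text \<open>A chord of sum class \<open>r\<close> links its two translates, of classes \<open>r + 2\<close> and \<open>r - 2\<close>; one of
  them has its colour as soon as the colour classes are long enough.\<close>

lemma chord_crossed:
  fixes m :: nat
  defines "n \<equiv> 2 * m + 1"
  assumes m: "4 \<le> m" and uv: "chord n u v"
  shows "\<exists>k<n. \<exists>l<n. k \<noteq> l \<and> crossing (colouring m B) u v k l"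
proof -
  have uvn: "u < n" "v < n" "u \<noteq> v"
    using uv by (auto simp: chord_def)
  obtain u' v' where u': "u' < n" "nxt n u' = u" and v': "v' < n" "nxt n v' = v"
    using nxt_surj uvn by metis
  define r where "r = (u + v) mod n"
  define r' where "r' = (u' + v') mod n"
  define r'' where "r'' = (nxt n u + nxt n v) mod n"
  have "r' < n" "r < n"
    by (auto simp: r'_def r_def n_def)
  have "r = (r' + 2) mod n"
    using nxt_sum_mod[OF u'(1) v'(1)] u' v' by (simp add: r_def r'_def)
  then have r: "r = (if r' + 2 < n then r' + 2 else r' + 2 - n)"
    using mod_add2[OF \<open>r' < n\<close>] m by (simp add: n_def)
  have r'': "r'' = (if r + 2 < n then r + 2 else r + 2 - n)"
    using nxt_sum_mod[OF uvn(1,2)] mod_add2[OF \<open>r < n\<close>] m by (simp add: r_def r''_def n_def)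
  have c: "r \<noteq> 0 \<Longrightarrow> colouring m B u v \<longleftrightarrow> r \<le> m"
    and c': "r' \<noteq> 0 \<Longrightarrow> colouring m B u' v' \<longleftrightarrow> r' \<le> m"
    and c'': "r'' \<noteq> 0 \<Longrightarrow> colouring m B (nxt n u) (nxt n v) \<longleftrightarrow> r'' \<le> m"
    unfolding r_def r'_def r''_def n_def by (rule colouring_class; assumption)+
  have "colouring m B u v = colouring m B (nxt n u) (nxt n v) \<or> colouring m B u v = colouring m B u' v'"
  proof -
    \<comment> \<open>At \<open>r = 0\<close> the page is a free choice, but the two translates lie
      on opposite pages. Otherwise a translate that stays within the same block of classes is taken;
      \<open>4 \<le> m\<close> leaves room for it, for instance from class \<open>2\<close> to class
      \<open>4\<close>.\<close>
    consider "r = 0" | "r \<in> {1, 2}" | "3 \<le> r" "r \<le> m" | "m < r" "r + 2 < n" | "m < r" "n \<le> r + 2"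
      using \<open>r < n\<close> by fastforce
    then show ?thesis
    proof cases
      case 1
      then have "r' = n - 2" "r'' = 2"
        using r r'' \<open>r' < n\<close> m by (auto simp: n_def split: if_splits)
      then show ?thesis
        using c' c'' m by (auto simp: n_def)
    next
      case 2
      then have "r'' = r + 2"
        using r'' m by (auto simp: n_def)
      then show ?thesis
        using 2 c c'' m by auto
    next
      case 3
      then have "r' = r - 2"
        using r \<open>r' < n\<close> m by (auto simp: n_def split: if_splits)
      then show ?thesis
        using 3 c c' m by auto
    next
      case 4
      then show ?thesis
        using c c'' r'' by auto
    next
      case 5
      then have "r' = r - 2"
        using r \<open>r' < n\<close> \<open>r < n\<close> m by (auto simp: n_def split: if_splits)
      moreover have "m < r - 2"
        using 5 m by (auto simp: n_def)
      ultimately show ?thesis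
        using 5 c c' m by auto
    qed
  qed
  moreover have "chord n u' v'"
    using chord_nxt[OF u'(1) v'(1)] u' v' uv by simp
  then have "crossing (colouring m B) u v u' v' \<longleftrightarrow> colouring m B u v = colouring m B u' v'"
    using crossing_nxt[of n u' v' "colouring m B"] crossing_commute u' v' by auto
  moreover note crossing_nxt[OF uv, of "colouring m B"]
  moreover have "u' \<noteq> v'" "nxt n u \<noteq> nxt n v" "nxt n u < n" "nxt n v < n"
    using u' v' uvn nxt_inj nxt_less by auto
  ultimately show ?thesis
    using u' v' by metis
qed

text \<open>Each step of the image goes forward or back, and by injectivity no step undoes the
  previous one, so the direction never changes.\<close>

lemma cycle_automorphism:
  assumes inj: "inj_on \<sigma> {..<n}" and ran: "\<And>u. u < n \<Longrightarrow> \<sigma> u < n" and n: "3 \<le> n"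
    and adj: "\<And>u. u < n \<Longrightarrow> adjacent n (\<sigma> u) (\<sigma> (nxt n u))"
  shows "(\<forall>u<n. \<sigma> (nxt n u) = nxt n (\<sigma> u)) \<or> (\<forall>u<n. nxt n (\<sigma> (nxt n u)) = \<sigma> u)"
proof -
  have no_return: "\<sigma> (nxt n (nxt n u)) \<noteq> \<sigma> u" if "u < n" for u
  proof -
    have "nxt n (nxt n u) \<noteq> u" "nxt n (nxt n u) < n"
      using that n by (auto simp: nxt_def)
    then show ?thesis
      using inj that by (auto simp: inj_on_def)
  qed
  have nxt_Suc: "nxt n u = Suc u" if "Suc u < n" for u
    using that by (simp add: nxt_def)
  consider "\<sigma> (nxt n 0) = nxt n (\<sigma> 0)" | "nxt n (\<sigma> (nxt n 0)) = \<sigma> 0"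
    using adj[of 0] n by (auto simp: adjacent_def)
  then show ?thesis
  proof cases
    case 1
    have "\<sigma> (nxt n u) = nxt n (\<sigma> u)" if "u < n" for u
      using that
    proof (induction u)
      case (Suc u)
      then have IH: "\<sigma> (nxt n u) = nxt n (\<sigma> u)" and u: "u < n" "nxt n u = Suc u"
        using nxt_Suc by auto
      show ?case
      proof (rule ccontr)
        assume "\<sigma> (nxt n (Suc u)) \<noteq> nxt n (\<sigma> (Suc u))"
        then have "nxt n (\<sigma> (nxt n (Suc u))) = \<sigma> (Suc u)"
          using adj[OF Suc.prems] by (auto simp: adjacent_def)
        then have "\<sigma> (nxt n (Suc u)) = \<sigma> u"
          using IH u nxt_inj ran nxt_less Suc.prems by metis
        then show False
          using no_return[OF u(1)] u by simp
      qed
    qed (rule 1)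
    then show ?thesis by blast
  next
    case 2
    have "nxt n (\<sigma> (nxt n u)) = \<sigma> u" if "u < n" for u
      using that
    proof (induction u)
      case (Suc u)
      then have IH: "nxt n (\<sigma> (nxt n u)) = \<sigma> u" and u: "u < n" "nxt n u = Suc u"
        using nxt_Suc by auto
      show ?case
      proof (rule ccontr)
        assume "nxt n (\<sigma> (nxt n (Suc u))) \<noteq> \<sigma> (Suc u)"
        then have "\<sigma> (nxt n (Suc u)) = nxt n (\<sigma> (Suc u))"
          using adj[OF Suc.prems] by (auto simp: adjacent_def)
        then show False
          using no_return[OF u(1)] u IH by simp
      qed
    qed (rule 2)
    then show ?thesis by blast
  qed
qed

lemma rotation_value:
  assumes "\<And>u. u < n \<Longrightarrow> \<sigma> u < n" "\<And>u. u < n \<Longrightarrow> \<sigma> (nxt n u) = nxt n (\<sigma> u)" "u < n"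
  shows "\<sigma> u = (\<sigma> 0 + u) mod n"
  using assms(3)
proof (induction u)
  case 0
  then show ?case
    using assms(1)[of 0] by simp
next
  case (Suc u)
  then have "\<sigma> (Suc u) = nxt n (\<sigma> u)"
    using assms(2)[of u] by (simp add: nxt_def)
  also have "\<dots> = (\<sigma> u + 1) mod n"
    using Suc.prems assms(1) by (intro nxt_mod) simp
  finally show ?case
    using Suc by (simp add: mod_Suc_eq)
qed

lemma reflection_value:
  assumes "\<And>u. u < n \<Longrightarrow> \<sigma> u < n" "\<And>u. u < n \<Longrightarrow> nxt n (\<sigma> (nxt n u)) = \<sigma> u" "u < n"
  shows "(\<sigma> u + u) mod n = \<sigma> 0"
  using assms(3)
proof (induction u)
  case 0
  then show ?case
    using assms(1)[of 0] by simp
next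
  case (Suc u)
  then have "\<sigma> u = nxt n (\<sigma> (Suc u))"
    using assms(2)[of u] by (simp add: nxt_def)
  also have "\<dots> = (\<sigma> (Suc u) + 1) mod n"
    using Suc.prems assms(1) by (intro nxt_mod) simp
  finally show ?case
    using Suc by (simp add: mod_add_left_eq)
qed

section \<open>Sum classes and rotation by one step\<close>

definition same_as_nxt :: "nat \<Rightarrow> nat set \<Rightarrow> nat \<Rightarrow> nat \<Rightarrow> bool" where
  "same_as_nxt m B u v \<longleftrightarrow>
     colouring m B u v = colouring m B (nxt (2 * m + 1) u) (nxt (2 * m + 1) v)"

text \<open>By \<open>crossing_nxt\<close>, \<open>same_as_nxt\<close> tells whether a chord crosses
  its own translate, so it can be read off the crossings. Classes showing both answers betray where
  the free edges are.\<close>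

definition mixed :: "nat \<Rightarrow> nat set \<Rightarrow> nat \<Rightarrow> bool" where
  "mixed m B r \<longleftrightarrow>
     (\<exists>u v. chord (2 * m + 1) u v \<and> (u + v) mod (2 * m + 1) = r \<and> same_as_nxt m B u v) \<and>
     (\<exists>u v. chord (2 * m + 1) u v \<and> (u + v) mod (2 * m + 1) = r \<and> \<not> same_as_nxt m B u v)"

text \<open>The pages of a chord and its translate are determined by the classes \<open>r\<close>
  and \<open>r + 2\<close> unless one of these is the free class \<open>0\<close>.\<close>

lemma mixed_class:
  assumes "mixed m B r" "1 \<le> m"
  shows "r = 0 \<or> r = 2 * m - 1"
proof (rule ccontr)
  let ?n = "2 * m + 1"
  assume r: "\<not> (r = 0 \<or> r = 2 * m - 1)"
  have "r < ?n"
    using assms by (auto simp: mixed_def)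
  have "same_as_nxt m B u v \<longleftrightarrow> (r \<le> m \<longleftrightarrow> (r + 2) mod ?n \<le> m)"
    if uv: "chord ?n u v" "(u + v) mod ?n = r" for u v
  proof -
    have "(nxt ?n u + nxt ?n v) mod ?n = (r + 2) mod ?n"
      using uv nxt_sum_mod by (simp add: chord_def)
    moreover have "(r + 2) mod ?n \<noteq> 0"
      using r mod_add2[OF \<open>r < ?n\<close>] assms by auto
    ultimately show ?thesis
      using uv r colouring_class[of u v m B] colouring_class[of "nxt ?n u" "nxt ?n v" m B]
      by (simp add: same_as_nxt_def)
  qed
  then show False
    using assms unfolding mixed_def by blast
qed

text \<open>The bound on \<open>k\<close> is strict because the free edge with \<open>k = m\<close>
  joins consecutive vertices and belongs to the cycle.\<close>

lemma chord_free: "1 \<le> k \<Longrightarrow> k < m \<Longrightarrow> chord (2 * m + 1) k (2 * m + 1 - k)"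
  by (auto simp: chord_def adjacent_def nxt_def)

lemma chord_before_free: "1 \<le> k \<Longrightarrow> k < m \<Longrightarrow> chord (2 * m + 1) (k - 1) (2 * m - k)"
  by (auto simp: chord_def adjacent_def nxt_def)

text \<open>The translate has class \<open>2\<close>, hence lies on the upper page. For
  \<open>k = 1\<close> the end \<open>2 * m\<close> wraps to \<open>0\<close> and the sum is
  \<open>2\<close> itself.\<close>

lemma same_as_nxt_free:
  assumes "1 \<le> k" "k < m"
  shows "same_as_nxt m B k (2 * m + 1 - k) \<longleftrightarrow> k \<in> B"
proof -
  have "colouring m B k (2 * m + 1 - k) \<longleftrightarrow> k \<in> B"
    using assms by (simp add: colouring_def)
  moreover have "colouring m B (nxt (2 * m + 1) k) (nxt (2 * m + 1) (2 * m + 1 - k))"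
  proof (cases "k = 1")
    case True
    then show ?thesis
      using assms colouring_small[of 2 0 m B] by (simp add: nxt_def numeral_2_eq_2)
  next
    case False
    then have "nxt (2 * m + 1) k + nxt (2 * m + 1) (2 * m + 1 - k) = 2 * m + 3"
      using assms by (auto simp: nxt_def)
    then show ?thesis
      using assms by (subst colouring_large) auto
  qed
  ultimately show ?thesis
    by (auto simp: same_as_nxt_def)
qed

text \<open>These chords have class \<open>2 * m - 1\<close>, so they lie on the lower page, and
  their translates are the free edges.\<close>

lemma same_as_nxt_before_free:
  assumes "1 \<le> k" "k < m"
  shows "same_as_nxt m B (k - 1) (2 * m - k) \<longleftrightarrow> k \<notin> B"
proof -
  have "nxt (2 * m + 1) (k - 1) = k" "nxt (2 * m + 1) (2 * m - k) = 2 * m + 1 - k"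
    using assms by (auto simp: nxt_def)
  moreover have "colouring m B k (2 * m + 1 - k) \<longleftrightarrow> k \<in> B"
    using assms by (simp add: colouring_def)
  moreover have "\<not> colouring m B (k - 1) (2 * m - k)"
    using assms by (subst colouring_small) auto
  ultimately show ?thesis
    by (auto simp: same_as_nxt_def)
qed

lemma mixed_intro:
  assumes "1 \<in> B" "2 \<le> k" "k < m" "k \<notin> B"
  shows "mixed m B 0" "mixed m B (2 * m - 1)"
proof -
  have k: "1 \<le> k" "k < m" "1 < m"
    using assms by auto
  have free: "chord (2 * m + 1) j (2 * m + 1 - j) \<and> (j + (2 * m + 1 - j)) mod (2 * m + 1) = 0 \<and>
      (same_as_nxt m B j (2 * m + 1 - j) \<longleftrightarrow> j \<in> B)"
    if "1 \<le> j" "j < m" for j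
    using chord_free[OF that] same_as_nxt_free[OF that] that by simp
  show "mixed m B 0"
    unfolding mixed_def using free[OF order_refl k(3)] free[OF k(1,2)] assms(1,4) by metis
  have before: "chord (2 * m + 1) (j - 1) (2 * m - j) \<and> (j - 1 + (2 * m - j)) mod (2 * m + 1) = 2 * m - 1 \<and>
      (same_as_nxt m B (j - 1) (2 * m - j) \<longleftrightarrow> j \<notin> B)"
    if "1 \<le> j" "j < m" for j
    using chord_before_free[OF that] same_as_nxt_before_free[OF that] that by simp
  show "mixed m B (2 * m - 1)"
    unfolding mixed_def using before[OF order_refl k(3)] before[OF k(1,2)] assms(1,4) by metis
qed

text \<open>Chords are exactly the edges crossed by something, so \<sigma> preserves the cycle and
  is a rotation or a reflection. Mixed classes go to mixed classes; \<open>1\<close> and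
  \<open>k0\<close> make both candidates of \<open>mixed_class\<close> mixed in the first drawing,
  which pins down \<open>\<sigma> 0\<close>.\<close>

lemma rigidity:
  fixes m :: nat
  defines "n \<equiv> 2 * m + 1"
  assumes m: "4 \<le> m" and bij: "bij_betw \<sigma> {..<n} {..<n}"
    and cross: "\<And>i j k l. i < n \<Longrightarrow> j < n \<Longrightarrow> k < n \<Longrightarrow> l < n \<Longrightarrow> i \<noteq> j \<Longrightarrow> k \<noteq> l \<Longrightarrow>
      crossing (colouring m B1) i j k l \<longleftrightarrow> crossing (colouring m B2) (\<sigma> i) (\<sigma> j) (\<sigma> k) (\<sigma> l)"
    and B: "B1 \<subseteq> {1..<m}" "B2 \<subseteq> {1..<m}" "1 \<in> B1" "1 \<in> B2"
    and mix: "2 \<le> k0" "k0 < m" "k0 \<notin> B1"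
  shows "B1 = B2"
proof -
  have inj: "inj_on \<sigma> {..<n}" and surj: "\<sigma> ` {..<n} = {..<n}"
    using bij by (auto simp: bij_betw_def)
  have ran: "\<sigma> u < n" if "u < n" for u
    using surj that by auto
  have \<sigma>_eq: "\<sigma> x = \<sigma> y \<longleftrightarrow> x = y" if "x < n" "y < n" for x y
    using inj that by (auto simp: inj_on_def)
  have chord_iff: "chord n (\<sigma> u) (\<sigma> v) \<longleftrightarrow> chord n u v" if uv: "u < n" "v < n" "u \<noteq> v" for u v
  proof -
    have "chord n u v \<longleftrightarrow> (\<exists>k<n. \<exists>l<n. k \<noteq> l \<and> crossing (colouring m B) u v k l)"
      if "u < n" "v < n" "u \<noteq> v" for u v B
      using chord_crossed[OF m, of u v B] adjacent_not_linked[of u n v] that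
      unfolding chord_def crossing_def n_def by blast
    moreover have "(\<exists>k<n. \<exists>l<n. k \<noteq> l \<and> crossing (colouring m B1) u v k l) \<longleftrightarrow>
        (\<exists>k\<in>\<sigma> ` {..<n}. \<exists>l\<in>\<sigma> ` {..<n}. k \<noteq> l \<and> crossing (colouring m B2) (\<sigma> u) (\<sigma> v) k l)"
      using cross[OF uv(1,2) _ _ uv(3)] \<sigma>_eq by auto
    ultimately show ?thesis
      using uv ran \<sigma>_eq unfolding surj by (simp add: Bex_def)
  qed
  have "adjacent n (\<sigma> u) (\<sigma> (nxt n u))" if "u < n" for u
  proof -
    have "nxt n u < n" "u \<noteq> nxt n u"
      using that m by (auto simp: nxt_def n_def)
    moreover have "\<not> chord n u (nxt n u)"
      by (simp add: chord_def adjacent_def)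
    ultimately show ?thesis
      using chord_iff[of u "nxt n u"] ran \<sigma>_eq that unfolding chord_def by auto
  qed
  then consider (rot) "\<forall>u<n. \<sigma> (nxt n u) = nxt n (\<sigma> u)" | (ref) "\<forall>u<n. nxt n (\<sigma> (nxt n u)) = \<sigma> u"
    using cycle_automorphism[OF inj ran] m by (auto simp: n_def)
  then show ?thesis
  proof cases
    case rot
    have same: "same_as_nxt m B1 u v \<longleftrightarrow> same_as_nxt m B2 (\<sigma> u) (\<sigma> v)" if uv: "chord n u v" for u v
    proof -
      have uvn: "u < n" "v < n" "u \<noteq> v"
        using uv by (auto simp: chord_def)
      then have "chord n (\<sigma> u) (\<sigma> v)"
        using chord_iff uv by simp
      moreover have "nxt n u < n" "nxt n v < n" "nxt n u \<noteq> nxt n v"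
        using uvn nxt_less nxt_inj by auto
      ultimately show ?thesis
        using cross[OF uvn(1,2) _ _ uvn(3), of "nxt n u" "nxt n v"] rot uvn
          crossing_nxt[OF uv, of "colouring m B1"]
          crossing_nxt[of n "\<sigma> u" "\<sigma> v" "colouring m B2"]
        unfolding same_as_nxt_def n_def[symmetric] by simp
    qed
    have sum_class: "(\<sigma> u + \<sigma> v) mod n = (2 * \<sigma> 0 + (u + v) mod n) mod n" if "u < n" "v < n" for u v
    proof -
      have "(\<sigma> u + \<sigma> v) mod n = ((\<sigma> 0 + u) + (\<sigma> 0 + v)) mod n"
        using rotation_value[of n \<sigma>] ran rot that by (metis mod_add_eq)
      also have "\<sigma> 0 + u + (\<sigma> 0 + v) = 2 * \<sigma> 0 + (u + v)"
        by simp
      finally show ?thesis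
        by (simp only: mod_add_right_eq)
    qed
    have transfer: "mixed m B2 ((2 * \<sigma> 0 + r) mod n)" if "mixed m B1 r" for r
    proof -
      have "chord n (\<sigma> u) (\<sigma> v) \<and> (\<sigma> u + \<sigma> v) mod n = (2 * \<sigma> 0 + r) mod n"
        if "chord n u v" "(u + v) mod n = r" for u v
        using that chord_iff sum_class by (auto simp: chord_def)
      then show ?thesis
        using that same unfolding mixed_def n_def[symmetric] by metis
    qed
    \<comment> \<open>A rotation adds \<open>d\<close> to every sum class and must send
      \<open>0\<close> and \<open>2 * m - 1\<close> into that same pair;
      \<open>d = 2 * m - 1\<close> would send \<open>2 * m - 1\<close> to
      \<open>2 * m - 3\<close>.\<close>
    define d where "d = (2 * \<sigma> 0) mod n"
    have d0: "d = 0 \<or> d = 2 * m - 1"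
      using mixed_class[OF transfer[OF mixed_intro(1)[OF B(3) mix]]] m by (simp add: d_def)
    have "(2 * \<sigma> 0 + (2 * m - 1)) mod n = (d + (2 * m - 1)) mod n"
      by (simp add: d_def mod_add_left_eq)
    then have d1: "(d + (2 * m - 1)) mod n = 0 \<or> (d + (2 * m - 1)) mod n = 2 * m - 1"
      using mixed_class[OF transfer[OF mixed_intro(2)[OF B(3) mix]]] m by simp
    have "d = 0"
    proof (rule ccontr)
      assume "d \<noteq> 0"
      then have "d + (2 * m - 1) = (2 * m - 3) + n"
        using d0 m by (simp add: n_def)
      then have "(d + (2 * m - 1)) mod n = (2 * m - 3) mod n"
        by (simp only: mod_add_self2)
      also have "\<dots> = 2 * m - 3"
        by (simp add: n_def)
      finally have "(d + (2 * m - 1)) mod n = 2 * m - 3" .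
      then show False
        using d1 m by auto
    qed
    then have "n dvd 2 * \<sigma> 0"
      by (simp add: d_def mod_eq_0_iff_dvd)
    moreover have "coprime n 2"
      by (simp add: n_def)
    ultimately have "n dvd \<sigma> 0"
      by (simp add: coprime_dvd_mult_right_iff)
    then have "\<sigma> 0 = 0"
      using ran[of 0] by (auto simp: n_def dest: dvd_imp_le)
    then have id: "\<sigma> u = u" if "u < n" for u
      using rotation_value[of n \<sigma> u, OF ran _ that] rot that by fastforce
    have "k \<in> B1 \<longleftrightarrow> k \<in> B2" if "1 \<le> k" "k < m" for k
      using same[of k "n - k"] chord_free[OF that] same_as_nxt_free[OF that] id[of k] id[of "n - k"] that
      by (simp add: n_def)
    then show ?thesis
      using B by (auto simp: subset_iff)
  next
    case ref
    \<comment> \<open>A reflection reverses the step, so the chord to compare with is the image of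
      the translate: its own translate is the image of the original chord.\<close>
    have same: "same_as_nxt m B1 u v \<longleftrightarrow> same_as_nxt m B2 (\<sigma> (nxt n u)) (\<sigma> (nxt n v))"
      and chord': "chord n (\<sigma> (nxt n u)) (\<sigma> (nxt n v))" if uv: "chord n u v" for u v
    proof -
      have uvn: "u < n" "v < n" "u \<noteq> v"
        using uv by (auto simp: chord_def)
      have nx: "nxt n u < n" "nxt n v < n" "nxt n u \<noteq> nxt n v"
        using uvn nxt_less nxt_inj by auto
      show ch: "chord n (\<sigma> (nxt n u)) (\<sigma> (nxt n v))"
        using chord_iff nx uv chord_nxt uvn by simp
      show "same_as_nxt m B1 u v \<longleftrightarrow> same_as_nxt m B2 (\<sigma> (nxt n u)) (\<sigma> (nxt n v))"
        using cross[OF uvn(1,2) nx(1,2) uvn(3) nx(3)] ref uvn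
          crossing_nxt[OF uv, of "colouring m B1"] crossing_nxt[OF ch, of "colouring m B2"]
          crossing_commute[of "colouring m B2" "\<sigma> u" "\<sigma> v"]
        unfolding same_as_nxt_def n_def[symmetric] by simp
    qed
    have sum_class: "((\<sigma> (nxt n u) + \<sigma> (nxt n v)) mod n + (u + v) mod n + 2) mod n = (2 * \<sigma> 0) mod n"
      if "u < n" "v < n" for u v
    proof -
      have val: "(\<sigma> (nxt n w) + w + 1) mod n = \<sigma> 0" if "w < n" for w
      proof -
        have "(\<sigma> (nxt n w) + nxt n w) mod n = \<sigma> 0"
          using reflection_value[of n \<sigma> "nxt n w", OF ran _ nxt_less[OF that]] ref by blast
        then show ?thesis
          unfolding nxt_mod[OF that] by (simp add: mod_add_right_eq)
      qed
      have "(2 * \<sigma> 0) mod n = ((\<sigma> (nxt n u) + u + 1) + (\<sigma> (nxt n v) + v + 1)) mod n"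
        using val[OF that(1)] val[OF that(2)] by (metis mod_add_eq mult_2)
      also have "\<dots> = ((\<sigma> (nxt n u) + \<sigma> (nxt n v)) + (u + v) + 2) mod n"
        by (simp add: ac_simps)
      also have "\<dots> = ((\<sigma> (nxt n u) + \<sigma> (nxt n v)) mod n + (u + v) mod n + 2) mod n"
        by (metis mod_add_eq mod_add_left_eq)
      finally show ?thesis by simp
    qed
    have transfer: "\<exists>r'. mixed m B2 r' \<and> (r' + r + 2) mod n = (2 * \<sigma> 0) mod n" if mx: "mixed m B1 r" for r
    proof -
      obtain u v where uv: "chord n u v" "(u + v) mod n = r" "same_as_nxt m B1 u v"
        using mx unfolding mixed_def n_def by blast
      obtain x y where xy: "chord n x y" "(x + y) mod n = r" "\<not> same_as_nxt m B1 x y"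
        using mx unfolding mixed_def n_def by blast
      let ?r1 = "(\<sigma> (nxt n u) + \<sigma> (nxt n v)) mod n" and ?r2 = "(\<sigma> (nxt n x) + \<sigma> (nxt n y)) mod n"
      have 1: "(?r1 + r + 2) mod n = (2 * \<sigma> 0) mod n" "(?r2 + r + 2) mod n = (2 * \<sigma> 0) mod n"
        using sum_class[of u v] sum_class[of x y] uv(1,2) xy(1,2) by (simp_all add: chord_def)
      then have "(?r1 + (r + 2)) mod n = (?r2 + (r + 2)) mod n"
        by (simp add: add.assoc)
      then have "?r1 = ?r2"
        by (rule mod_add_cancel_less[rotated 2]) (simp_all add: n_def)
      then show ?thesis
        using 1 uv xy same chord' unfolding mixed_def n_def[symmetric] by metis
    qed
    \<comment> \<open>By \<open>transfer\<close>, starting from class \<open>0\<close> leaves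
      \<open>d\<close> equal to \<open>0\<close> or \<open>2\<close>, and starting from
      \<open>2 * m - 1\<close> leaves \<open>0\<close> or \<open>2 * m - 1\<close>; the only common
      value is \<open>0\<close>.\<close>
    define d where "d = (2 * \<sigma> 0) mod n"
    obtain r where r: "mixed m B2 r" "(r + 2) mod n = d"
      using transfer[OF mixed_intro(1)[OF B(3) mix]] by (auto simp: d_def)
    have "r = 0 \<or> r = 2 * m - 1"
      using mixed_class[OF r(1)] m by simp
    then have d0: "d = 2 \<or> d = 0"
      using r(2) m by (auto simp: n_def)
    obtain r' where r': "mixed m B2 r'" "(r' + (2 * m - 1) + 2) mod n = d"
      using transfer[OF mixed_intro(2)[OF B(3) mix]] by (auto simp: d_def)
    have "r' = 0 \<or> r' = 2 * m - 1"
      using mixed_class[OF r'(1)] m by simp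
    moreover have "r' + (2 * m - 1) + 2 = r' + n"
      using m by (simp add: n_def)
    then have "d = r' mod n"
      using r'(2) by (simp only: mod_add_self2)
    ultimately have "d = 0 \<or> d = 2 * m - 1"
      by (auto simp: n_def)
    with d0 have "d = 0"
      using m by auto
    then have "n dvd 2 * \<sigma> 0"
      by (simp add: d_def mod_eq_0_iff_dvd)
    moreover have "coprime n 2"
      by (simp add: n_def)
    ultimately have "n dvd \<sigma> 0"
      by (simp add: coprime_dvd_mult_right_iff)
    then have \<sigma>0: "\<sigma> 0 = 0"
      using ran[of 0] by (auto simp: n_def dest: dvd_imp_le)
    have "(\<sigma> 2 + 2) mod n = 0"
      using reflection_value[of n \<sigma> 2, OF ran] ref \<sigma>0 m by (fastforce simp: n_def)
    then have \<sigma>2: "\<sigma> 2 = 2 * m - 1"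
      using ran[of 2] mod_add2[of "\<sigma> 2" n] m by (auto simp: n_def split: if_splits)
    have nx: "nxt n 1 = 2" "nxt n (2 * m) = 0"
      using m by (auto simp: nxt_def n_def)
    \<comment> \<open>The reflection fixing \<open>0\<close> sends the free edge at \<open>1\<close>
      and its translate to a lower chord followed by that free edge. Agreement would put the edge on
      opposite pages in the two drawings, contrary to \<open>1\<close> lying in both sets.\<close>
    have "same_as_nxt m B1 1 (2 * m) \<longleftrightarrow> same_as_nxt m B2 (2 * m - 1) 0"
      using same[of 1 "2 * m"] chord_free[of 1 m] m nx \<sigma>0 \<sigma>2 by (simp add: n_def)
    moreover have "same_as_nxt m B2 (2 * m - 1) 0 \<longleftrightarrow> same_as_nxt m B2 0 (2 * m - 1)"
      by (simp add: same_as_nxt_def colouring_def add.commute min.commute)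
    ultimately show ?thesis
      using same_as_nxt_free[of 1 m B1] same_as_nxt_before_free[of 1 m B2] B m by simp
  qed
qed

section \<open>The case of seven vertices\<close>

text \<open>Pairs are ordered here, so that three crossing edges are counted as six pairs.\<close>

definition triply_crossed :: "nat \<Rightarrow> (nat \<Rightarrow> nat \<Rightarrow> bool) \<Rightarrow> (nat \<times> nat) set" where
  "triply_crossed n c = {e \<in> {..<n} \<times> {..<n}.
     card {f \<in> {..<n} \<times> {..<n}. crossing c (fst e) (snd e) (fst f) (snd f)} = 6}"

lemma card_triply_crossed_invariant:
  assumes bij: "bij_betw \<sigma> {..<n} {..<n}"
    and cross: "\<And>i j k l. i < n \<Longrightarrow> j < n \<Longrightarrow> k < n \<Longrightarrow> l < n \<Longrightarrow> i \<noteq> j \<Longrightarrow> k \<noteq> l \<Longrightarrow>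
      crossing c1 i j k l \<longleftrightarrow> crossing c2 (\<sigma> i) (\<sigma> j) (\<sigma> k) (\<sigma> l)"
  shows "card (triply_crossed n c1) = card (triply_crossed n c2)"
proof -
  let ?P = "{..<n} \<times> {..<n}"
  let ?C = "\<lambda>c e. {f \<in> ?P. crossing c (fst e) (snd e) (fst f) (snd f)}"
  have bijP: "bij_betw (map_prod \<sigma> \<sigma>) ?P ?P"
    using bij by (rule bij_betw_map_prod) fact
  \<comment> \<open>\<open>cross\<close> speaks of proper edges only; degenerate ones never cross,
    which extends the equivalence to all ordered pairs.\<close>
  have degenerate: "\<not> crossing c i i k l" "\<not> crossing c i j k k" for c i j k l
    by (auto simp: crossing_def linked_def)
  have inj: "\<sigma> i = \<sigma> j \<longleftrightarrow> i = j" if "i < n" "j < n" for i j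
    using bij that by (auto simp: bij_betw_def inj_on_def)
  have iff: "crossing c1 i j k l \<longleftrightarrow> crossing c2 (\<sigma> i) (\<sigma> j) (\<sigma> k) (\<sigma> l)"
    if "i < n" "j < n" "k < n" "l < n" for i j k l
    using cross that degenerate by (cases "i = j \<or> k = l") auto
  have deg: "card (?C c1 e) = card (?C c2 (map_prod \<sigma> \<sigma> e))" if e: "e \<in> ?P" for e
  proof -
    have "map_prod \<sigma> \<sigma> f \<in> ?C c2 (map_prod \<sigma> \<sigma> e) \<longleftrightarrow> f \<in> ?C c1 e" if "f \<in> ?P" for f
      using e that iff bij_betwE[OF bijP] by (cases e; cases f) auto
    then have "bij_betw (map_prod \<sigma> \<sigma>) {f \<in> ?P. f \<in> ?C c1 e} {f \<in> ?P. f \<in> ?C c2 (map_prod \<sigma> \<sigma> e)}"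
      by (intro bij_betw_Collect[OF bijP])
    then show ?thesis
      using bij_betw_same_card by fastforce
  qed
  have "bij_betw (map_prod \<sigma> \<sigma>) {e \<in> ?P. card (?C c1 e) = 6} {e \<in> ?P. card (?C c2 e) = 6}"
    using deg by (intro bij_betw_Collect[OF bijP]) simp
  then show ?thesis
    unfolding triply_crossed_def by (rule bij_betw_same_card)
qed

lemma triply_crossed_code:
  "card (triply_crossed n c) = (let P = List.product [0..<n] [0..<n] in
     length (filter (\<lambda>e. length (filter (\<lambda>f. crossing c (fst e) (snd e) (fst f) (snd f)) P) = 6) P))"
proof -
  let ?P = "List.product [0..<n] [0..<n]"
  have P: "set ?P = {..<n} \<times> {..<n}" "distinct ?P"
    by (auto simp: distinct_product)
  have count: "card {e \<in> {..<n} \<times> {..<n}. Q e} = length (filter Q ?P)" for Q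
    using distinct_card[OF distinct_filter[OF P(2), of Q]] unfolding set_filter P(1) .
  show ?thesis
    unfolding triply_crossed_def count Let_def by simp
qed

text \<open>Settles \<open>m = 3\<close>, which is below the bound of \<open>chord_crossed\<close>.
  Edges are counted as ordered pairs, so one edge has three crossings in the first drawing and two
  edges have in the second.\<close>

lemma card_triply_crossed_seven:
  "card (triply_crossed 7 (colouring 3 {1})) = 2"
  "card (triply_crossed 7 (colouring 3 {1, 2})) = 4"
  unfolding triply_crossed_code by code_simp+

section \<open>Assembling the family of drawings\<close>

lemma homeomorphic_drawings_sym:
  assumes "homeomorphic_drawings n D1 D2"
  shows "homeomorphic_drawings n D2 D1"
proof -
  obtain h g where hg: "homeomorphism UNIV UNIV h g"
    and V: "h ` vertex_points n D1 = vertex_points n D2"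
    and E: "(\<lambda>A. h ` A) ` edge_images n D1 = edge_images n D2"
    using assms unfolding homeomorphic_drawings_def by blast
  have gh: "g ` h ` A = A" for A
    using hg by (simp add: image_image homeomorphism_apply1)
  have "g ` vertex_points n D2 = vertex_points n D1"
    unfolding V[symmetric] by (rule gh)
  moreover have "(\<lambda>A. g ` A) ` edge_images n D2 = edge_images n D1"
    unfolding E[symmetric] image_image[of "\<lambda>A. g ` A"] gh by simp
  ultimately show ?thesis
    unfolding homeomorphic_drawings_def using homeomorphism_symD[OF hg] by blast
qed

lemma colouring_commute: "colouring m B i j = colouring m B j i"
  by (simp add: colouring_def add.commute min.commute)

lemma homeomorphic_colourings_eq:
  assumes m: "3 \<le> m" and B: "B1 \<subseteq> {1..<m}" "B2 \<subseteq> {1..<m}" "1 \<in> B1" "1 \<in> B2"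
    and homeo: "homeomorphic_drawings (2 * m + 1) (book (colouring m B1)) (book (colouring m B2))"
  shows "B1 = B2"
proof (cases "m = 3")
  case True
  obtain \<sigma> where "bij_betw \<sigma> {..<2 * m + 1} {..<2 * m + 1}"
    and "\<And>i j k l. i < 2 * m + 1 \<Longrightarrow> j < 2 * m + 1 \<Longrightarrow> k < 2 * m + 1 \<Longrightarrow> l < 2 * m + 1 \<Longrightarrow>
      i \<noteq> j \<Longrightarrow> k \<noteq> l \<Longrightarrow>
      crossing (colouring m B1) i j k l \<longleftrightarrow> crossing (colouring m B2) (\<sigma> i) (\<sigma> j) (\<sigma> k) (\<sigma> l)"
    using homeomorphic_books_permutation[OF homeo] colouring_commute by metis
  then have card_eq: "card (triply_crossed (2 * m + 1) (colouring m B1)) =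
      card (triply_crossed (2 * m + 1) (colouring m B2))"
    by (rule card_triply_crossed_invariant)
  have cases: "B = {1} \<or> B = {1, 2}" if "B \<subseteq> {1..<m}" "1 \<in> B" for B
  proof -
    have "{1..<m} = {1, 2}"
      using True by auto
    then show ?thesis
      using that by auto
  qed
  show ?thesis
    using cases[OF B(1,3)] cases[OF B(2,4)] card_eq card_triply_crossed_seven True by auto
next
  case False
  then have m4: "4 \<le> m"
    using m by simp
  have rigid: "B = B'"
    if h: "homeomorphic_drawings (2 * m + 1) (book (colouring m B)) (book (colouring m B'))"
      and k: "B \<subseteq> {1..<m}" "B' \<subseteq> {1..<m}" "1 \<in> B" "1 \<in> B'" "2 \<le> k" "k < m" "k \<notin> B" for B B' k
  proof -
    obtain \<sigma> where "bij_betw \<sigma> {..<2 * m + 1} {..<2 * m + 1}"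
      and "\<And>i j k l. i < 2 * m + 1 \<Longrightarrow> j < 2 * m + 1 \<Longrightarrow> k < 2 * m + 1 \<Longrightarrow> l < 2 * m + 1 \<Longrightarrow>
        i \<noteq> j \<Longrightarrow> k \<noteq> l \<Longrightarrow>
        crossing (colouring m B) i j k l \<longleftrightarrow> crossing (colouring m B') (\<sigma> i) (\<sigma> j) (\<sigma> k) (\<sigma> l)"
      using homeomorphic_books_permutation[OF h] colouring_commute by metis
    then show ?thesis
      by (rule rigidity[OF m4 _ _ k])
  qed
  \<comment> \<open>\<open>rigidity\<close> asks for a missing \<open>k\<close> in the first set. If
    it is missing from the second instead, the inverse homeomorphism is used; if nothing is missing,
    both sets are \<open>{1..<m}\<close>.\<close>
  consider k where "2 \<le> k" "k < m" "k \<notin> B1" | k where "2 \<le> k" "k < m" "k \<notin> B2"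
    | "{2..<m} \<subseteq> B1" "{2..<m} \<subseteq> B2"
    by fastforce
  then show ?thesis
  proof cases
    case 1
    then show ?thesis
      using rigid[OF homeo] B by blast
  next
    case 2
    then show ?thesis
      using rigid[OF homeomorphic_drawings_sym[OF homeo]] B by blast
  next
    case 3
    have "{1..<m} = insert 1 {2..<m}"
      using m by auto
    then have "{1..<m} \<subseteq> B1" "{1..<m} \<subseteq> B2"
      using 3 B by auto
    then show ?thesis
      using B by blast
  qed
qed

lemma crossings_colouring: "real (crossings (2 * m + 1) (book (colouring m B))) = Z (2 * m + 1)"
proof -
  have "4 * crossings (2 * m + 1) (book (colouring m B)) = m\<^sup>2 * (m - 1)\<^sup>2"
    using card_monochromatic[of m B] by (simp add: crossings_book monochromatic_def)
  then have "4 * real (crossings (2 * m + 1) (book (colouring m B))) = (real m)\<^sup>2 * (real (m - 1))\<^sup>2"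
    by (metis of_nat_mult of_nat_numeral of_nat_power)
  also have "\<dots> = (real m)\<^sup>2 * (real m - 1)\<^sup>2"
    by (cases m) auto
  moreover have "int (2 * m + 1) div 2 = int m" "(int (2 * m + 1) - 1) div 2 = int m"
    "(int (2 * m + 1) - 2) div 2 = int m - 1" "(int (2 * m + 1) - 3) div 2 = int m - 1"
    by simp_all
  then have "4 * Z (2 * m + 1) = (real m)\<^sup>2 * (real m - 1)\<^sup>2"
    unfolding Z_def by (simp only: of_int_mult of_int_diff of_int_of_nat_eq of_int_1) (simp add: power2_eq_square)
  ultimately show ?thesis
    by linarith
qed

theorem theorem23:
  fixes n :: nat
  assumes "odd n"
  shows "\<exists>S :: drawing set. finite S \<and> 2 powr ((real n - 5) / 2) \<le> real (card S) \<and>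
           (\<forall>D \<in> S. two_page_drawing n D \<and> real (crossings n D) = Z n) \<and>
           (\<forall>D1 \<in> S. \<forall>D2 \<in> S. D1 \<noteq> D2 \<longrightarrow> \<not> homeomorphic_drawings n D1 D2)"
proof -
  obtain m where n: "n = 2 * m + 1"
    using assms by (elim oddE)
  let ?D = "\<lambda>B. book (colouring m B)"
  have good: "two_page_drawing n (?D B) \<and> real (crossings n (?D B)) = Z n" for B
    using two_page_drawing_book crossings_colouring by (simp add: n)
  have exponent: "(real n - 5) / 2 = real m - 2"
    by (simp add: n)
  show ?thesis
  proof (cases "3 \<le> m")
    \<comment> \<open>The exponent \<open>m - 2\<close> is at most \<open>0\<close> here, so a
      single drawing is enough.\<close>
    case False
    then have "2 powr ((real n - 5) / 2) \<le> 2 powr 0"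
      unfolding exponent by (intro powr_mono) auto
    then show ?thesis
      using good by (intro exI[of _ "{?D {}}"]) simp
  next
    case True
    \<comment> \<open>There are \<open>m - 2\<close> binary choices, for
      \<open>k = 2, ..., m - 1\<close>: the page of the free edge at \<open>1\<close> is fixed to
      break the mirror symmetry, and the one at \<open>m\<close> is a cycle edge.\<close>
    define F where "F = insert 1 ` Pow {2..<m}"
    have F: "B \<subseteq> {1..<m} \<and> 1 \<in> B" if "B \<in> F" for B
      using that True by (auto simp: F_def)
    have eq: "B1 = B2" if "B1 \<in> F" "B2 \<in> F" "homeomorphic_drawings n (?D B1) (?D B2)" for B1 B2
      using homeomorphic_colourings_eq[OF True] F that by (simp add: n)
    \<comment> \<open>Reflexivity lets \<open>eq\<close> also show that distinct sets give distinct
      drawings, so that the cardinality of the family is that of \<open>F\<close>.\<close>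
    have refl: "homeomorphic_drawings n D D" for D
      unfolding homeomorphic_drawings_def using homeomorphism_ident[of UNIV] by force
    have "inj_on (insert 1) (Pow {2..<m})"
    proof (rule inj_onI)
      fix X Y assume "X \<in> Pow {2..<m}" "Y \<in> Pow {2..<m}" and XY: "insert 1 X = insert 1 Y"
      then have "1 \<notin> X" "1 \<notin> Y"
        by auto
      then show "X = Y"
        using XY by (simp add: insert_ident)
    qed
    then have "card F = 2 ^ (m - 2)"
      by (simp add: F_def card_image card_Pow)
    moreover have "inj_on ?D F"
    proof (rule inj_onI)
      fix B1 B2 assume "B1 \<in> F" "B2 \<in> F" "?D B1 = ?D B2"
      then show "B1 = B2"
        using eq[of B1 B2] refl[of "?D B1"] by simp
    qed
    ultimately have "card (?D ` F) = 2 ^ (m - 2)"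
      by (simp add: card_image)
    moreover have "2 powr ((real n - 5) / 2) = 2 ^ (m - 2)"
      unfolding exponent using True by (simp add: powr_realpow[symmetric] of_nat_diff)
    ultimately have "2 powr ((real n - 5) / 2) \<le> real (card (?D ` F))"
      by simp
    moreover have "finite (?D ` F)"
      by (simp add: F_def)
    moreover have "\<not> homeomorphic_drawings n D1 D2" if "D1 \<in> ?D ` F" "D2 \<in> ?D ` F" "D1 \<noteq> D2" for D1 D2
      using eq that by blast
    ultimately show ?thesis
      using good by (intro exI[of _ "?D ` F"]) auto
  qed
qed

end
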